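(* Let $n=3$, and let $A$ be any non-scalar real symmetric $3\times3$ matrix having a multiple eigenvalue. Then the orbit $\mathrm{Orbit}(A)=\{gAg^{*}\mid g\in\mathrm{SO}(3)\}$ satisfies the following. (1) It is a 2-dimensional algebraic surface lying on a 4-dimensional sphere and diffeomorphic to the projective plane $\mathbb{R}P(2)$. (2) It contains the union of a smooth single-parameter family of circumferences (circles) of the same radius having the common point $A$. (3) It is not contained in any four-dimensional (affine) plane.
   Context: $\mathrm{Sym}(3)$ is the 6-dimensional space of real symmetric $3\times 3$ matrices, with the Euclidean inner product $\langle X,Y\rangle=\sum_{i,j}x_{i,j}y_{i,j}$; spheres, circumferences and radii are understood in this metric (a circumference is a round circle in a 2-dimensional affine plane of $\mathrm{Sym}(3)$). $g^{*}$ denotes the transpose of $g$. A scalar matrix is a real multiple of the identity matrix. An algebraic surface is a common zero set in $\mathrm{Sym}(3)$ of finitely many real polynomials in the matrix entries. *)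

theory Defs
  imports "HOL-Analysis.Analysis" "HOL-Computational_Algebra.Polynomial"
begin

section \<open>Smooth maps\<close>

text \<open>In finite dimension, \<open>Ck_on k W f\<close> on an open set \<open>W\<close> says that all iterated directional
  derivatives of order at most \<open>k\<close> exist and are continuous.\<close>

primrec Ck_on :: "nat \<Rightarrow> 'a::euclidean_space set \<Rightarrow> ('a \<Rightarrow> 'b::real_normed_vector) \<Rightarrow> bool" where
  "Ck_on 0 W f \<longleftrightarrow> continuous_on W f"
| "Ck_on (Suc k) W f \<longleftrightarrow>
     (\<exists>f'. (\<forall>x\<in>W. (f has_derivative f' x) (at x)) \<and> (\<forall>v. Ck_on k W (\<lambda>x. f' x v)))"

text \<open>Smoothness of a map on an arbitrary subset of a Euclidean space, by local smooth extension
  to open sets of the ambient space (Milnor). On an open set this is ordinary \<open>C\<^sup>\<infinity>\<close>.\<close>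

definition smooth_on :: "'a::euclidean_space set \<Rightarrow> ('a \<Rightarrow> 'b::real_normed_vector) \<Rightarrow> bool" where
  "smooth_on S f \<longleftrightarrow>
     (\<forall>x\<in>S. \<exists>W g. open W \<and> x \<in> W \<and> (\<forall>k. Ck_on k W g) \<and> (\<forall>y\<in>S \<inter> W. g y = f y))"

section \<open>Smooth manifolds\<close>

text \<open>A chart is a domain together with a coordinate map. The dimension of a manifold is the
  dimension of the type \<open>'e\<close> of the coordinate space.\<close>

type_synonym ('a, 'e) chart = "'a set \<times> ('a \<Rightarrow> 'e)"

definition is_chart :: "'a topology \<Rightarrow> ('a, 'e::euclidean_space) chart \<Rightarrow> bool" where
  "is_chart X = (\<lambda>(U, \<phi>). openin X U \<and> open (\<phi> ` U) \<and>
     homeomorphic_map (subtopology X U) (top_of_set (\<phi> ` U)) \<phi>)"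

definition smooth_atlas :: "'a topology \<Rightarrow> ('a, 'e::euclidean_space) chart set \<Rightarrow> bool" where
  "smooth_atlas X \<A> \<longleftrightarrow>
     (\<forall>c\<in>\<A>. is_chart X c) \<and> \<Union> (fst ` \<A>) = topspace X \<and>
     (\<forall>(U, \<phi>)\<in>\<A>. \<forall>(V, \<psi>)\<in>\<A>. smooth_on (\<phi> ` (U \<inter> V)) (\<psi> \<circ> inv_into U \<phi>))"

definition smooth_manifold :: "'a topology \<Rightarrow> ('a, 'e::euclidean_space) chart set \<Rightarrow> bool" where
  "smooth_manifold X \<A> \<longleftrightarrow> Hausdorff_space X \<and> second_countable X \<and> smooth_atlas X \<A>"

definition diffeomorphism ::
    "'a topology \<Rightarrow> ('a, 'e::euclidean_space) chart set \<Rightarrow>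
     'b topology \<Rightarrow> ('b, 'e) chart set \<Rightarrow> ('a \<Rightarrow> 'b) \<Rightarrow> bool" where
  "diffeomorphism X \<A> Y \<B> f \<longleftrightarrow>
     homeomorphic_map X Y f \<and>
     (\<forall>(U, \<phi>)\<in>\<A>. \<forall>(V, \<psi>)\<in>\<B>.
        smooth_on (\<phi> ` (U \<inter> f -` V)) (\<psi> \<circ> f \<circ> inv_into U \<phi>) \<and>
        smooth_on (\<psi> ` (V \<inter> f ` U)) (\<phi> \<circ> inv_into (topspace X) f \<circ> inv_into V \<psi>))"

definition diffeomorphic ::
    "'a topology \<Rightarrow> ('a, 'e::euclidean_space) chart set \<Rightarrow>
     'b topology \<Rightarrow> ('b, 'e) chart set \<Rightarrow> bool" where
  "diffeomorphic X \<A> Y \<B> \<longleftrightarrow>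
     smooth_manifold X \<A> \<and> smooth_manifold Y \<B> \<and> (\<exists>f. diffeomorphism X \<A> Y \<B> f)"

text \<open>The smooth structure that a subset \<open>M\<close> of a Euclidean space inherits: all diffeomorphisms from
  relatively open subsets of \<open>M\<close> onto open subsets of \<open>'e\<close>. Their domains cover \<open>M\<close>
  iff \<open>M\<close> is a smooth embedded submanifold of dimension \<open>DIM('e)\<close>.\<close>

definition submanifold_atlas :: "'a::euclidean_space set \<Rightarrow> ('a, 'e::euclidean_space) chart set" where
  "submanifold_atlas M = {(U, \<phi>). openin (top_of_set M) U \<and> open (\<phi> ` U) \<and> inj_on \<phi> U \<and>
     smooth_on U \<phi> \<and> smooth_on (\<phi> ` U) (inv_into U \<phi>)}"

section \<open>The real projective plane\<close>

text \<open>Lines through the origin of \<open>\<real>\<^sup>3\<close>, with the quotient topology from \<open>\<real>\<^sup>3 - {0}\<close>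
  and the three affine charts.\<close>

definition RP2 :: "(real ^ 3) set set" where
  "RP2 = {span {x} | x. x \<noteq> 0}"

definition RP2_topology :: "(real ^ 3) set topology" where
  "RP2_topology = topology (\<lambda>V. V \<subseteq> RP2 \<and> open {x. x \<noteq> 0 \<and> span {x} \<in> V})"

text \<open>Indices in type \<open>3\<close> are taken modulo 3, so \<open>i + 1\<close> and \<open>i + 2\<close> are the two indices
  different from \<open>i\<close>.\<close>

definition RP2_chart :: "3 \<Rightarrow> ((real ^ 3) set, real ^ 2) chart" where
  "RP2_chart i = ({L \<in> RP2. \<exists>x\<in>L. x $ i \<noteq> 0},
     \<lambda>L. let x = (THE x. x \<in> L \<and> x $ i = 1) in vector [x $ (i + 1), x $ (i + 2)])"

definition RP2_atlas :: "((real ^ 3) set, real ^ 2) chart set" where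
  "RP2_atlas = range RP2_chart"

lemma openin_RP2_topology:
  "openin RP2_topology V \<longleftrightarrow> V \<subseteq> RP2 \<and> open {x. x \<noteq> 0 \<and> span {x} \<in> V}"
proof -
  have "istopology (\<lambda>V. V \<subseteq> RP2 \<and> open {x::real^3. x \<noteq> 0 \<and> span {x} \<in> V})"
    unfolding istopology_def
  proof (intro conjI allI impI)
    fix S T :: "(real^3) set set"
    assume S: "S \<subseteq> RP2 \<and> open {x. x \<noteq> 0 \<and> span {x} \<in> S}"
      and T: "T \<subseteq> RP2 \<and> open {x. x \<noteq> 0 \<and> span {x} \<in> T}"
    show "S \<inter> T \<subseteq> RP2"
      using S by blast
    have "{x. x \<noteq> 0 \<and> span {x} \<in> S \<inter> T} = {x. x \<noteq> 0 \<and> span {x} \<in> S} \<inter> {x. x \<noteq> 0 \<and> span {x} \<in> T}"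
      by blast
    then show "open {x. x \<noteq> 0 \<and> span {x} \<in> S \<inter> T}"
      using S T by (simp add: open_Int)
  next
    fix \<K> :: "(real^3) set set set"
    assume K: "\<forall>K\<in>\<K>. K \<subseteq> RP2 \<and> open {x. x \<noteq> 0 \<and> span {x} \<in> K}"
    show "\<Union> \<K> \<subseteq> RP2"
      using K by blast
    have "{x. x \<noteq> 0 \<and> span {x} \<in> \<Union> \<K>} = (\<Union>K\<in>\<K>. {x. x \<noteq> 0 \<and> span {x} \<in> K})"
      by blast
    then show "open {x. x \<noteq> 0 \<and> span {x} \<in> \<Union> \<K>}"
      using K by (simp add: open_UN)
  qed
  then show ?thesis
    by (simp add: RP2_topology_def topology_inverse')
qed

lemma RP2_chart_span:
  assumes "x $ i \<noteq> 0"
  shows "snd (RP2_chart i) (span {x}) = vector [x $ (i + 1) / x $ i, x $ (i + 2) / x $ i]"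
proof -
  have "(THE y. y \<in> span {x} \<and> y $ i = 1) = (1 / x $ i) *\<^sub>R x"
  proof (rule the_equality)
    show "(1 / x $ i) *\<^sub>R x \<in> span {x} \<and> ((1 / x $ i) *\<^sub>R x) $ i = 1"
      using assms by (simp add: span_base span_mul)
    fix y assume y: "y \<in> span {x} \<and> y $ i = 1"
    then obtain k where "y = k *\<^sub>R x"
      by (auto simp: span_singleton)
    with y assms show "y = (1 / x $ i) *\<^sub>R x"
      by (simp add: field_simps)
  qed
  then show ?thesis
    by (simp add: RP2_chart_def)
qed

section \<open>Symmetric matrices and orbits\<close>

text \<open>\<open>Sym3\<close> is a subspace of the type \<open>real ^ 3 ^ 3\<close>, whose inner product is the sum of the
  products of corresponding entries.\<close>

definition Sym3 :: "(real ^ 3 ^ 3) set" where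
  "Sym3 = {X. transpose X = X}"

definition scalar_matrix :: "real ^ 'n ^ 'n \<Rightarrow> bool" where
  "scalar_matrix A \<longleftrightarrow> (\<exists>a. A = mat a)"

definition charpoly :: "real ^ 'n ^ 'n \<Rightarrow> real poly" where
  "charpoly A = det (\<chi> i j. (if i = j then [:0, 1:] else 0) - [:A $ i $ j:])"

definition has_multiple_eigenvalue :: "real ^ 'n ^ 'n \<Rightarrow> bool" where
  "has_multiple_eigenvalue A \<longleftrightarrow> (\<exists>a. order a (charpoly A) \<ge> 2)"

definition SO3_orbit :: "real ^ 3 ^ 3 \<Rightarrow> (real ^ 3 ^ 3) set" where
  "SO3_orbit A = {g ** A ** transpose g | g. rotation_matrix g}"

definition algebraic_in_Sym3 :: "(real ^ 3 ^ 3) set \<Rightarrow> bool" where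
  "algebraic_in_Sym3 S \<longleftrightarrow>
     (\<exists>P. finite P \<and> (\<forall>p\<in>P. real_polynomial_function p) \<and> S = {X \<in> Sym3. \<forall>p\<in>P. p X = 0})"

section \<open>Round spheres and families of circles\<close>

definition round_sphere :: "nat \<Rightarrow> 'a::euclidean_space set \<Rightarrow> bool" where
  "round_sphere k S \<longleftrightarrow>
     (\<exists>L c r. affine L \<and> aff_dim L = int k + 1 \<and> c \<in> L \<and> 0 < r \<and> S = sphere c r \<inter> L)"

text \<open>Circles of radius \<open>r\<close> whose centre \<open>c t\<close> and affine plane \<open>c t + span {u t, v t}\<close> depend
  smoothly on the parameter \<open>t\<close>, which runs over an interval. Injectivity makes this a genuine
  single-parameter family and excludes, for example, a constant one.\<close>

definition smooth_circle_family ::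
    "real set \<Rightarrow> real \<Rightarrow> (real \<Rightarrow> 'a::euclidean_space set) \<Rightarrow> bool" where
  "smooth_circle_family I r C \<longleftrightarrow>
     is_interval I \<and> open I \<and> I \<noteq> {} \<and> 0 < r \<and> inj_on C I \<and>
     (\<exists>c u v. smooth_on I c \<and> smooth_on I u \<and> smooth_on I v \<and>
        (\<forall>t\<in>I. dim {u t, v t} = 2 \<and> C t = sphere (c t) r \<inter> (+) (c t) ` span {u t, v t}))"

end

theory Submission
  imports Defs
begin

text \<open>A double eigenvalue forces \<open>A = mat a + b *\<^sub>R outer e e\<close> with \<open>e\<close> a unit vector and
  \<open>b \<noteq> 0\<close>. Hence the orbit consists of the matrices \<open>mat a + b *\<^sub>R outer x x\<close> with \<open>x\<close> a unit
  vector, one for each line through the origin: it is a Veronese surface, cut out by the trace and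
  the \<open>2 \<times> 2\<close> minors of \<open>X - mat a\<close>. Sending a matrix of the orbit to its \<open>(a + b)\<close>-eigenline is the
  diffeomorphism to the projective plane. The lines in a fixed plane through \<open>e\<close> give a circle
  through \<open>A\<close>. The matrices \<open>outer x x\<close> span all symmetric matrices, so the affine hull of the orbit is
  the whole hyperplane of symmetric matrices of trace \<open>3 * a + b\<close>.\<close>

section \<open>Calculus of smooth maps\<close>

text \<open>Smoothness on a subset asks for local extensions to open sets of the ambient space, so
  the parametrisation and charts of the orbit are rational formulas that make sense off the orbit.
  \<open>line_pt\<close> divides by \<open>x \<bullet> x\<close> instead of normalising
  \<open>x\<close>; it then depends only on the line of \<open>x\<close> and is smooth away from 0.
  The charts of the orbit are quotients of entries of \<open>X - mat a\<close>, chosen to match the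
  affine charts of the projective plane, so that the eigenline map is the identity in coordinates.
  Both the manifold structure of the projective plane and the smoothness of the eigenline map in
  either direction then reduce to transition maps of the orbit. The circles have equal radii because
  each has as a diameter the segment from \<open>A\<close> to the point of a line orthogonal to
  \<open>e\<close>, and all such segments have length \<open>\<bar>b\<bar> * sqrt 2\<close>. Their
  parameter is the slope \<open>t\<close>, so that it runs over an open interval; the plane spanned
  by \<open>e\<close> and \<open>g\<close> is left out.\<close>

lemma Ck_on_Suc_imp: "Ck_on (Suc k) W f \<Longrightarrow> Ck_on k W f"
proof (induction k arbitrary: f)
  case 0
  then obtain f' where "\<forall>x\<in>W. (f has_derivative f' x) (at x)"
    by auto
  then show ?case
    by (auto intro!: continuous_at_imp_continuous_on has_derivative_continuous)
next
  case (Suc k)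
  then show ?case
    by (metis Ck_on.simps(2))
qed

lemma Ck_on_subset: "Ck_on k W f \<Longrightarrow> V \<subseteq> W \<Longrightarrow> Ck_on k V f"
proof (induction k arbitrary: f)
  case 0
  then show ?case
    by (auto intro: continuous_on_subset)
next
  case (Suc k)
  then show ?case
    by (simp, meson subsetD)
qed

lemma Ck_on_const: "Ck_on k W (\<lambda>x. c)"
proof (induction k arbitrary: c)
  case (Suc k)
  have "\<forall>x\<in>W. ((\<lambda>x. c) has_derivative (\<lambda>v. 0)) (at x)"
    by simp
  with Suc show ?case
    by (auto intro!: exI[of _ "\<lambda>_ _. 0"])
qed simp

lemma Ck_on_bounded_linear:
  assumes "bounded_linear f"
  shows "Ck_on k W f"
proof (cases k)
  case 0
  then show ?thesis
    using assms linear_continuous_on by auto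
next
  case (Suc l)
  have "\<forall>x\<in>W. (f has_derivative f) (at x)"
    using assms bounded_linear_imp_has_derivative by blast
  with Suc show ?thesis
    by (auto intro!: exI[of _ "\<lambda>_. f"] Ck_on_const)
qed

lemma Ck_on_add: "Ck_on k W f \<Longrightarrow> Ck_on k W g \<Longrightarrow> Ck_on k W (\<lambda>x. f x + g x)"
proof (induction k arbitrary: f g)
  case 0
  then show ?case
    by (auto intro: continuous_intros)
next
  case (Suc k)
  from Suc.prems obtain f' g' where
    "\<forall>x\<in>W. (f has_derivative f' x) (at x)" "\<forall>v. Ck_on k W (\<lambda>x. f' x v)"
    "\<forall>x\<in>W. (g has_derivative g' x) (at x)" "\<forall>v. Ck_on k W (\<lambda>x. g' x v)"
    by auto
  with Suc.IH show ?case
    by (auto intro!: exI[of _ "\<lambda>x v. f' x v + g' x v"] has_derivative_add)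
qed

lemma Ck_on_sum: "(\<And>i. i \<in> I \<Longrightarrow> Ck_on k W (f i)) \<Longrightarrow> Ck_on k W (\<lambda>x. \<Sum>i\<in>I. f i x)"
  by (induction I rule: infinite_finite_induct) (auto intro: Ck_on_const Ck_on_add)

text \<open>The product rule yields two terms of the same shape \<open>h _ _\<close>, with one
  factor differentiated, so the induction closes when \<open>f\<close> and \<open>g\<close> are
  arbitrary. The one rule serves products, scalar multiples, inner products and outer
  products.\<close>

lemma Ck_on_bilinear:
  assumes "bounded_bilinear h"
  shows "Ck_on k W f \<Longrightarrow> Ck_on k W g \<Longrightarrow> Ck_on k W (\<lambda>x. h (f x) (g x))"
proof (induction k arbitrary: f g)
  case 0
  then show ?case
    using bounded_bilinear.continuous_on[OF assms] by auto
next
  case (Suc k)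
  from Suc.prems obtain f' g' where
    der: "\<forall>x\<in>W. (f has_derivative f' x) (at x)" "\<forall>v. Ck_on k W (\<lambda>x. f' x v)"
    "\<forall>x\<in>W. (g has_derivative g' x) (at x)" "\<forall>v. Ck_on k W (\<lambda>x. g' x v)"
    by auto
  have "Ck_on k W f" "Ck_on k W g"
    using Suc.prems Ck_on_Suc_imp by blast+
  then have "\<forall>v. Ck_on k W (\<lambda>x. h (f x) (g' x v) + h (f' x v) (g x))"
    using der by (auto intro!: Ck_on_add Suc.IH)
  moreover have "\<forall>x\<in>W. ((\<lambda>x. h (f x) (g x)) has_derivative
      (\<lambda>v. h (f x) (g' x v) + h (f' x v) (g x))) (at x)"
    using der bounded_bilinear.FDERIV[OF assms] by blast
  ultimately show ?case
    by (auto intro!: exI[of _ "\<lambda>x v. h (f x) (g' x v) + h (f' x v) (g x)"])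
qed

text \<open>The derivative of the inverse is a product of the inverse, twice, with the derivative of
  \<open>f\<close>. The induction hypothesis for the inverse and the bilinear rule therefore give
  one more order.\<close>

lemma Ck_on_inverse:
  fixes f :: "'a::euclidean_space \<Rightarrow> real"
  assumes "\<And>x. x \<in> W \<Longrightarrow> f x \<noteq> 0"
  shows "Ck_on k W f \<Longrightarrow> Ck_on k W (\<lambda>x. inverse (f x))"
proof (induction k)
  case 0
  then show ?case
    using assms by (auto intro!: continuous_intros)
next
  case (Suc k)
  then obtain f' where
    der: "\<forall>x\<in>W. (f has_derivative f' x) (at x)" "\<forall>v. Ck_on k W (\<lambda>x. f' x v)"
    by auto
  define d where "d = (\<lambda>x v. - 1 * (inverse (f x) * f' x v * inverse (f x)))"
  have inv: "Ck_on k W (\<lambda>x. inverse (f x))"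
    using Suc Ck_on_Suc_imp by blast
  have "\<forall>v. Ck_on k W (\<lambda>x. d x v)"
    unfolding d_def using inv der
    by (intro allI Ck_on_bilinear[OF bounded_bilinear_mult] Ck_on_const) auto
  moreover have "\<forall>x\<in>W. ((\<lambda>x. inverse (f x)) has_derivative d x) (at x)"
    using der assms by (auto simp: d_def intro!: derivative_eq_intros)
  ultimately show ?case
    by auto
qed

text \<open>\<open>Ck_on\<close> controls \<open>g'\<close> only in fixed directions, whereas the
  chain rule evaluates \<open>g' (f x)\<close> in the direction \<open>f' x v\<close>, which varies
  with \<open>x\<close>. Expanding that direction in \<open>Basis\<close> leaves fixed directions
  with \<open>Ck_on\<close> coefficients.\<close>

lemma Ck_on_compose:
  fixes f :: "'a::euclidean_space \<Rightarrow> 'b::euclidean_space"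
    and g :: "'b \<Rightarrow> 'c::real_normed_vector"
  assumes "f ` W \<subseteq> V"
  shows "Ck_on k W f \<Longrightarrow> Ck_on k V g \<Longrightarrow> Ck_on k W (\<lambda>x. g (f x))"
proof (induction k arbitrary: g)
  case 0
  then show ?case
    using assms continuous_on_compose2[of V g W f] by simp
next
  case (Suc k)
  from Suc.prems obtain f' g' where
    der: "\<forall>x\<in>W. (f has_derivative f' x) (at x)" "\<forall>v. Ck_on k W (\<lambda>x. f' x v)"
    "\<forall>y\<in>V. (g has_derivative g' y) (at y)" "\<forall>v. Ck_on k V (\<lambda>y. g' y v)"
    by auto
  have comp: "\<forall>x\<in>W. ((\<lambda>x. g (f x)) has_derivative (\<lambda>v. g' (f x) (f' x v))) (at x)"
  proof
    fix x assume "x \<in> W"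
    then show "((\<lambda>x. g (f x)) has_derivative (\<lambda>v. g' (f x) (f' x v))) (at x)"
      using der assms by (intro has_derivative_compose[of f "f' x" x UNIV g]) auto
  qed
  have "Ck_on k W f"
    using Suc.prems(1) by (rule Ck_on_Suc_imp)
  then have "Ck_on k W (\<lambda>x. g' (f x) b)" for b
    using der Suc.IH by blast
  then have "Ck_on k W (\<lambda>x. \<Sum>b\<in>Basis. (f' x v \<bullet> b) *\<^sub>R g' (f x) b)" for v
    using der by (intro Ck_on_sum Ck_on_bilinear[OF bounded_bilinear_scaleR]
        Ck_on_bilinear[OF bounded_bilinear_inner] Ck_on_const) simp_all
  moreover have "\<forall>x\<in>W. ((\<lambda>x. g (f x)) has_derivative
      (\<lambda>v. \<Sum>b\<in>Basis. (f' x v \<bullet> b) *\<^sub>R g' (f x) b)) (at x)"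
  proof
    fix x assume x: "x \<in> W"
    then have "linear (g' (f x))"
      using der assms has_derivative_linear by blast
    then have "g' (f x) w = (\<Sum>b\<in>Basis. (w \<bullet> b) *\<^sub>R g' (f x) b)" for w
      using linear_sum[of "g' (f x)" "\<lambda>b. (w \<bullet> b) *\<^sub>R b" Basis]
      by (simp add: linear_scale euclidean_representation)
    then have "(\<lambda>v. g' (f x) (f' x v)) = (\<lambda>v. \<Sum>b\<in>Basis. (f' x v \<bullet> b) *\<^sub>R g' (f x) b)"
      by blast
    with comp x show "((\<lambda>x. g (f x)) has_derivative
        (\<lambda>v. \<Sum>b\<in>Basis. (f' x v \<bullet> b) *\<^sub>R g' (f x) b)) (at x)"
      by metis
  qed
  ultimately show ?case
    unfolding Ck_on.simps by (intro exI conjI allI) assumption+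
qed

lemma smooth_on_open: "open S \<Longrightarrow> (\<And>k. Ck_on k S f) \<Longrightarrow> smooth_on S f"
  unfolding smooth_on_def by blast

lemma smooth_on_subset: "smooth_on S f \<Longrightarrow> T \<subseteq> S \<Longrightarrow> smooth_on T f"
  unfolding smooth_on_def Ball_def Int_iff by (meson subsetD)

lemma smooth_on_cong: "smooth_on S f \<Longrightarrow> (\<And>x. x \<in> S \<Longrightarrow> f x = g x) \<Longrightarrow> smooth_on S g"
  unfolding smooth_on_def by (metis IntD1)

lemma smooth_on_imp_continuous_on:
  assumes "smooth_on S f"
  shows "continuous_on S f"
  unfolding continuous_on_eq_continuous_within
proof
  fix x assume x: "x \<in> S"
  then obtain W g where W: "open W" "x \<in> W" "Ck_on 0 W g" "\<forall>y\<in>S \<inter> W. g y = f y"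
    using assms unfolding smooth_on_def by blast
  have "continuous (at x within S) g"
    using W by (simp add: continuous_on_eq_continuous_at continuous_at_imp_continuous_at_within)
  moreover have "\<forall>\<^sub>F y in at x within S. g y = f y"
    using W eventually_at_topological by blast
  ultimately show "continuous (at x within S) f"
    using W x by (simp add: continuous_within tendsto_cong)
qed

lemma smooth_on_compose:
  fixes f :: "'a::euclidean_space \<Rightarrow> 'b::euclidean_space"
    and g :: "'b \<Rightarrow> 'c::real_normed_vector"
  assumes f: "smooth_on S f" and g: "smooth_on T g" and "f ` S \<subseteq> T"
  shows "smooth_on S (\<lambda>x. g (f x))"
  unfolding smooth_on_def
proof
  fix x assume x: "x \<in> S"
  then obtain W F where W: "open W" "x \<in> W" "\<forall>k. Ck_on k W F" "\<forall>y\<in>S \<inter> W. F y = f y"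
    using f unfolding smooth_on_def by blast
  have "f x \<in> T"
    using x assms by blast
  then obtain V G where V: "open V" "f x \<in> V" "\<forall>k. Ck_on k V G" "\<forall>y\<in>T \<inter> V. G y = g y"
    using g unfolding smooth_on_def by blast
  \<comment> \<open>\<open>F\<close> agrees with \<open>f\<close> only on \<open>S\<close> and may
    leave \<open>V\<close> elsewhere, so \<open>W\<close> is cut down to the part that
    \<open>F\<close> maps into \<open>V\<close>, which is open by continuity.\<close>
  have "continuous_on W F"
    using W Ck_on.simps(1) by blast
  then have "open (W \<inter> F -` V)"
    using W V continuous_open_preimage by blast
  moreover have "Ck_on k (W \<inter> F -` V) (\<lambda>x. G (F x))" for k
  proof (rule Ck_on_compose[where V = V])
    show "Ck_on k (W \<inter> F -` V) F"
      using W by (meson Ck_on_subset inf_le1)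
  qed (use V in auto)
  moreover have "x \<in> W \<inter> F -` V"
    using x W V by auto
  moreover have "\<forall>y\<in>S \<inter> (W \<inter> F -` V). G (F y) = g (f y)"
    using W V assms by auto
  ultimately show "\<exists>W h. open W \<and> x \<in> W \<and> (\<forall>k. Ck_on k W h) \<and> (\<forall>y\<in>S \<inter> W. h y = g (f y))"
    by blast
qed

section \<open>Submanifolds of Euclidean space\<close>

lemma is_chart_submanifold_atlas:
  assumes "(U, \<phi>) \<in> submanifold_atlas M"
  shows "is_chart (top_of_set M) (U, \<phi>)"
proof -
  have U: "openin (top_of_set M) U" "open (\<phi> ` U)" "inj_on \<phi> U" "smooth_on U \<phi>"
    "smooth_on (\<phi> ` U) (inv_into U \<phi>)"
    using assms by (auto simp: submanifold_atlas_def)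
  then have "U \<subseteq> M"
    by (simp add: openin_imp_subset)
  then have "subtopology (top_of_set M) U = top_of_set U"
    by (simp add: subtopology_subtopology inf.absorb2)
  moreover have "homeomorphic_maps (top_of_set U) (top_of_set (\<phi> ` U)) \<phi> (inv_into U \<phi>)"
    using U by (auto simp: homeomorphic_maps_def smooth_on_imp_continuous_on inv_into_into f_inv_into_f)
  then have "homeomorphic_map (top_of_set U) (top_of_set (\<phi> ` U)) \<phi>"
    using homeomorphic_map_maps by blast
  ultimately show ?thesis
    using U by (simp add: is_chart_def)
qed

lemma submanifold_atlas_domain:
  assumes "(U, \<phi>) \<in> submanifold_atlas M"
  shows "U \<subseteq> M" "inj_on \<phi> U"
  using assms by (auto simp: submanifold_atlas_def dest!: openin_imp_subset)

text \<open>Charts and their inverses are both smooth by definition of the atlas, so a transition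
  map is a composition of smooth maps and no implicit function argument enters. All smoothness goals
  of the transport lemma below are instances.\<close>

lemma submanifold_transition_smooth:
  assumes "(U, \<phi>) \<in> submanifold_atlas M" "(V, \<psi>) \<in> submanifold_atlas M"
    "S \<subseteq> \<phi> ` (U \<inter> V)"
  shows "smooth_on S (\<lambda>y. \<psi> (inv_into U \<phi> y))"
proof (rule smooth_on_compose[where T = V])
  have inj: "inj_on \<phi> U"
    using assms by (simp add: submanifold_atlas_def)
  then show "inv_into U \<phi> ` S \<subseteq> V"
    using assms by (auto simp: inv_into_f_f)
  have "S \<subseteq> \<phi> ` U"
    using assms by auto
  then show "smooth_on S (inv_into U \<phi>)" "smooth_on V \<psi>"
    using assms smooth_on_subset by (auto simp: submanifold_atlas_def)
qed

lemma second_countable_euclidean: "second_countable (euclidean :: 'a::second_countable_topology topology)"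
proof -
  obtain B :: "'a set set" where "countable B" "topological_basis B"
    using ex_countable_basis by blast
  then show ?thesis
    unfolding second_countable_def
    by (intro exI[of _ B]) (metis open_openin topological_basisE topological_basis_open)
qed

lemma smooth_manifold_submanifold_atlas:
  fixes M :: "'a::euclidean_space set"
  assumes "M \<subseteq> \<Union> (fst ` (submanifold_atlas M :: ('a, 'e::euclidean_space) chart set))"
  shows "smooth_manifold (top_of_set M) (submanifold_atlas M :: ('a, 'e) chart set)"
  unfolding smooth_manifold_def smooth_atlas_def
proof (intro conjI ballI)
  show "\<Union> (fst ` (submanifold_atlas M :: ('a, 'e) chart set)) = topspace (top_of_set M)"
  proof
    show "\<Union> (fst ` (submanifold_atlas M :: ('a, 'e) chart set)) \<subseteq> topspace (top_of_set M)"
      using submanifold_atlas_domain(1) by (force simp: subset_iff)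
  qed (use assms in simp)
  show "is_chart (top_of_set M) c" if "c \<in> (submanifold_atlas M :: ('a, 'e) chart set)" for c
    using that is_chart_submanifold_atlas by (cases c) blast
  show "second_countable (top_of_set M)"
    by (rule second_countable_subtopology[OF second_countable_euclidean])
qed (auto simp: Hausdorff_space_subtopology o_def intro: submanifold_transition_smooth)

text \<open>If each chart of \<open>Y\<close>, pulled back along \<open>f\<close>, is a chart of
  \<open>M\<close>, then \<open>f\<close> is the identity in coordinates. Every coordinate
  expression for \<open>f\<close>, for its inverse or for a change of charts on \<open>Y\<close> is
  then a transition map of \<open>M\<close>. Hausdorffness and second countability of
  \<open>Y\<close> are topological and carry over along the homeomorphism.\<close>

lemma diffeomorphic_submanifold_transport:
  fixes M :: "'a::euclidean_space set" and f :: "'a \<Rightarrow> 'b"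
    and \<B> :: "('b, 'e::euclidean_space) chart set"
  assumes hom: "homeomorphic_map (top_of_set M) Y f"
    and cover: "\<Union> (fst ` \<B>) = topspace Y"
    and charts: "\<And>V \<psi>. (V, \<psi>) \<in> \<B> \<Longrightarrow>
      \<exists>D \<phi>. (D, \<phi>) \<in> submanifold_atlas M \<and> V = f ` D \<and> (\<forall>x\<in>D. \<psi> (f x) = \<phi> x)"
  shows "diffeomorphic (top_of_set M) (submanifold_atlas M) Y \<B>"
proof -
  have inj: "inj_on f M" and surj: "f ` M = topspace Y"
    using hom homeomorphic_imp_injective_map homeomorphic_imp_surjective_map by fastforce+
  obtain g where g: "homeomorphic_maps (top_of_set M) Y f g"
    using hom homeomorphic_map_maps by blast
  have chart: "\<exists>D \<phi>. (D, \<phi>) \<in> submanifold_atlas M \<and> D \<subseteq> M \<and> V = f ` D \<and> inj_on \<phi> D \<and>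
      (\<forall>x\<in>D. \<psi> (f x) = \<phi> x \<and> inv_into V \<psi> (\<phi> x) = f x)" if B: "(V, \<psi>) \<in> \<B>" for V \<psi>
  proof -
    obtain D \<phi> where D: "(D, \<phi>) \<in> submanifold_atlas M" "V = f ` D" "\<forall>x\<in>D. \<psi> (f x) = \<phi> x"
      using charts[OF B] by blast
    then have *: "inj_on \<phi> D" "D \<subseteq> M"
      using submanifold_atlas_domain[OF D(1)] by simp_all
    then have "inj_on \<psi> V"
      using D by (auto simp: inj_on_def)
    then have "inv_into V \<psi> (\<phi> x) = f x" if "x \<in> D" for x
      using D that by (metis imageI inv_into_f_f)
    with D * show ?thesis
      by blast
  qed
  have "x \<in> \<Union> (fst ` (submanifold_atlas M :: ('a, 'e) chart set))" if x: "x \<in> M" for x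
  proof -
    obtain V \<psi> where V: "(V, \<psi>) \<in> \<B>" "f x \<in> V"
      using cover surj x by force
    then obtain D \<phi> where "(D, \<phi>) \<in> (submanifold_atlas M :: ('a, 'e) chart set)" "D \<subseteq> M" "V = f ` D"
      using chart by blast
    moreover from this V x have "x \<in> D"
      using inj_on_image_mem_iff[OF inj] by blast
    ultimately show ?thesis
      by force
  qed
  then have M: "smooth_manifold (top_of_set M) (submanifold_atlas M :: ('a, 'e) chart set)"
    by (intro smooth_manifold_submanifold_atlas) blast
  have "is_chart Y (V, \<psi>)" if B: "(V, \<psi>) \<in> \<B>" for V \<psi>
  proof -
    obtain D \<phi> where D: "(D, \<phi>) \<in> submanifold_atlas M" "D \<subseteq> M" "V = f ` D" "\<forall>x\<in>D. \<psi> (f x) = \<phi> x"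
      using chart[OF B] by blast
    then have "is_chart (top_of_set M) (D, \<phi>)"
      using is_chart_submanifold_atlas by blast
    then have phi: "openin (top_of_set M) D" "open (\<phi> ` D)"
      "homeomorphic_map (subtopology (top_of_set M) D) (top_of_set (\<phi> ` D)) \<phi>"
      by (auto simp: is_chart_def)
    have im: "\<psi> ` V = \<phi> ` D"
      unfolding D(3) image_image using D(4) by simp
    have "openin Y V"
      using D phi hom homeomorphic_map_openness[of "top_of_set M" Y f D] by simp
    moreover have "homeomorphic_maps (subtopology (top_of_set M) D) (subtopology Y V) f g"
      using g D surj by (intro homeomorphic_maps_subtopologies) (auto simp: Int_absorb1)
    then have gV: "homeomorphic_map (subtopology Y V) (subtopology (top_of_set M) D) g"
      using homeomorphic_maps_map by blast
    \<comment> \<open>On \<open>V\<close> the chart \<open>\<psi>\<close> equals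
      \<open>\<phi> \<circ> g\<close>, a composition of two homeomorphisms.\<close>
    have "homeomorphic_map (subtopology Y V) (top_of_set (\<psi> ` V)) \<psi>"
    proof (rule homeomorphic_map_eq)
      show "homeomorphic_map (subtopology Y V) (top_of_set (\<psi> ` V)) (\<phi> \<circ> g)"
        unfolding im by (rule homeomorphic_map_compose[OF gV phi(3)])
      fix y assume "y \<in> topspace (subtopology Y V)"
      then obtain x where "x \<in> D" "y = f x"
        using D by auto
      moreover have "g (f x) = x" if "x \<in> M" for x
        using g that by (simp add: homeomorphic_maps_def)
      ultimately show "(\<phi> \<circ> g) y = \<psi> y"
        using D by auto
    qed
    ultimately show ?thesis
      using phi im by (simp add: is_chart_def)
  qed
  moreover have "smooth_on (\<psi> ` (V \<inter> V')) (\<psi>' \<circ> inv_into V \<psi>)"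
    if B: "(V, \<psi>) \<in> \<B>" "(V', \<psi>') \<in> \<B>" for V \<psi> V' \<psi>'
  proof -
    obtain D \<phi> where D: "(D, \<phi>) \<in> submanifold_atlas M" "D \<subseteq> M" "V = f ` D" "inj_on \<phi> D"
      "\<forall>x\<in>D. \<psi> (f x) = \<phi> x \<and> inv_into V \<psi> (\<phi> x) = f x"
      using chart[OF B(1)] by blast
    obtain D' \<phi>' where D': "(D', \<phi>') \<in> submanifold_atlas M" "D' \<subseteq> M" "V' = f ` D'"
      "\<forall>x\<in>D'. \<psi>' (f x) = \<phi>' x"
      using chart[OF B(2)] by blast
    have "V \<inter> V' = f ` (D \<inter> D')"
      using D D' inj_on_image_Int[OF inj, of D D'] by simp
    then have im: "\<psi> ` (V \<inter> V') = \<phi> ` (D \<inter> D')"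
      using D(5) by (simp add: image_image)
    show ?thesis
      unfolding im
      by (rule smooth_on_cong[OF submanifold_transition_smooth[OF D(1) D'(1) order_refl]])
        (use D D' in \<open>auto simp: inv_into_f_f\<close>)
  qed
  ultimately have Y: "smooth_manifold Y \<B>"
    unfolding smooth_manifold_def smooth_atlas_def
    using cover M homeomorphic_map_imp_homeomorphic_space[OF hom, THEN homeomorphic_Hausdorff_space]
      homeomorphic_map_imp_homeomorphic_space[OF hom, THEN homeomorphic_space_second_countability]
    by (auto simp: smooth_manifold_def)
  have "diffeomorphism (top_of_set M) (submanifold_atlas M) Y \<B> f"
    unfolding diffeomorphism_def
  proof (intro conjI hom ballI, safe)
    fix U V and \<phi>' :: "'a \<Rightarrow> 'e" and \<psi> :: "'b \<Rightarrow> 'e"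
    assume U: "(U, \<phi>') \<in> submanifold_atlas M" and V: "(V, \<psi>) \<in> \<B>"
    obtain D \<phi> where D: "(D, \<phi>) \<in> submanifold_atlas M" "D \<subseteq> M" "V = f ` D" "inj_on \<phi> D"
      "\<forall>x\<in>D. \<psi> (f x) = \<phi> x \<and> inv_into V \<psi> (\<phi> x) = f x"
      using chart[OF V] by blast
    have U': "U \<subseteq> M" "inj_on \<phi>' U"
      using submanifold_atlas_domain[OF U] by simp_all
    then have UV: "U \<inter> f -` V = U \<inter> D"
      using D inj by (auto simp: inj_on_def) (metis subsetD)
    show "smooth_on (\<phi>' ` (U \<inter> f -` V)) (\<psi> \<circ> f \<circ> inv_into U \<phi>')"
      unfolding UV
      by (rule smooth_on_cong[OF submanifold_transition_smooth[OF U D(1) order_refl]])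
        (use D U' in \<open>auto simp: inv_into_f_f\<close>)
    have "V \<inter> f ` U = f ` (D \<inter> U)"
      using D U' inj_on_image_Int[OF inj, of D U] by simp
    then have im: "\<psi> ` (V \<inter> f ` U) = \<phi> ` (D \<inter> U)"
      using D(5) by (simp add: image_image)
    show "smooth_on (\<psi> ` (V \<inter> f ` U)) (\<phi>' \<circ> inv_into (topspace (top_of_set M)) f \<circ> inv_into V \<psi>)"
      unfolding im
      by (rule smooth_on_cong[OF submanifold_transition_smooth[OF D(1) U order_refl]])
        (use D U' inj in \<open>auto simp: inv_into_f_f\<close>)
  qed
  with M Y show ?thesis
    unfolding diffeomorphic_def by blast
qed

section \<open>Symmetric matrices of rank one\<close>

definition outer :: "real ^ 'n \<Rightarrow> real ^ 'n \<Rightarrow> real ^ 'n ^ 'n" where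
  "outer x y = (\<chi> i j. x $ i * y $ j)"

lemma outer_nth [simp]: "outer x y $ i $ j = x $ i * y $ j"
  by (simp add: outer_def)

lemma bounded_bilinear_outer: "bounded_bilinear outer"
  unfolding bilinear_conv_bounded_bilinear[symmetric] bilinear_def
  by (auto intro!: linearI simp: vec_eq_iff algebra_simps)

lemma inner_outer: "outer x y \<bullet> outer u v = (x \<bullet> u) * (y \<bullet> v)"
  by (simp add: inner_vec_def sum_product ac_simps)

lemma outer_mult_vec: "outer x y *v v = (y \<bullet> v) *\<^sub>R x"
  by (simp add: vec_eq_iff matrix_vector_mult_def inner_vec_def sum_distrib_right sum_distrib_left ac_simps)

lemma conjugate_outer: "g ** outer x y ** transpose g = outer (g *v x) (g *v y)"
proof -
  have "(\<Sum>k\<in>UNIV. (\<Sum>l\<in>UNIV. g $ i $ l * (x $ l * y $ k)) * g $ j $ k)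
      = (\<Sum>l\<in>UNIV. g $ i $ l * x $ l) * (\<Sum>k\<in>UNIV. g $ j $ k * y $ k)" for i j
    unfolding sum_product by (subst sum.swap) (simp add: sum_distrib_left sum_distrib_right ac_simps)
  then show ?thesis
    by (simp add: vec_eq_iff matrix_matrix_mult_def matrix_vector_mult_def transpose_def)
qed

lemma symmetric_nth: "transpose Y = Y \<Longrightarrow> Y $ i $ j = Y $ j $ i"
  by (drule arg_cong[where f = "\<lambda>Z. Z $ j $ i"]) (simp add: transpose_def)

text \<open>The minor on rows and columns \<open>i\<close>, \<open>j\<close> gives
  \<open>Y $ j $ j * Y $ i $ i = (Y $ i $ j)\<^sup>2\<close>; sum over \<open>j\<close>. In
  particular a nonzero row forces its diagonal entry and the trace to be nonzero and of the same
  sign.\<close>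

lemma trace_mult_diag:
  fixes Y :: "real ^ 'n ^ 'n"
  assumes sym: "transpose Y = Y"
    and minors: "\<forall>i j k l. Y $ i $ j * Y $ k $ l = Y $ i $ l * Y $ k $ j"
  shows "trace Y * Y $ i $ i = (\<Sum>j\<in>UNIV. (Y $ i $ j)\<^sup>2)"
proof -
  have "Y $ j $ j * Y $ i $ i = (Y $ i $ j)\<^sup>2" for j
    using minors[rule_format, of j j i i] symmetric_nth[OF sym, of i j] by (simp add: power2_eq_square)
  then show ?thesis
    by (simp add: trace_def sum_distrib_right)
qed

text \<open>Each row of a rank-one symmetric matrix is a multiple of the wanted vector. Take a
  nonzero row \<open>i\<close> and divide by \<open>sqrt (b * Y $ i $ i)\<close>: by the previous
  identity the radicand is the squared length of that row, hence positive even when the trace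
  \<open>b\<close> is negative.\<close>

lemma symmetric_rank_one:
  fixes Y :: "real ^ 'n ^ 'n"
  assumes sym: "transpose Y = Y" and "Y \<noteq> 0"
    and minors: "\<forall>i j k l. Y $ i $ j * Y $ k $ l = Y $ i $ l * Y $ k $ j"
  obtains x where "trace Y \<noteq> 0" "norm x = 1" "Y = trace Y *\<^sub>R outer x x"
proof -
  define b where "b = trace Y"
  obtain i j where "Y $ i $ j \<noteq> 0"
    using \<open>Y \<noteq> 0\<close> by (auto simp: vec_eq_iff)
  then have "(\<Sum>j\<in>UNIV. (Y $ i $ j)\<^sup>2) > 0"
    by (intro sum_pos2[of _ j]) auto
  moreover have bi: "b * Y $ i $ i = (\<Sum>j\<in>UNIV. (Y $ i $ j)\<^sup>2)"
    unfolding b_def by (intro trace_mult_diag assms)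
  ultimately have pos: "b * Y $ i $ i > 0"
    by simp
  then have "b \<noteq> 0" "Y $ i $ i \<noteq> 0"
    using pos by auto
  define x where "x = (\<chi> j. Y $ i $ j / sqrt (b * Y $ i $ i))"
  have "x \<bullet> x = 1"
    using pos bi unfolding x_def by (simp add: inner_vec_def power2_eq_square flip: sum_divide_distrib)
  then have "norm x = 1"
    by (simp add: norm_eq_1)
  moreover have "b * (x $ j * x $ k) = Y $ j $ k" for j k
  proof -
    have "Y $ i $ j * Y $ i $ k = Y $ i $ i * Y $ j $ k"
      using minors[rule_format, of i j i k] minors[rule_format, of i i j k] symmetric_nth[OF sym, of i j]
      by simp
    then show ?thesis
      using pos \<open>b \<noteq> 0\<close> \<open>Y $ i $ i \<noteq> 0\<close> by (simp add: x_def field_simps)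
  qed
  then have "Y = b *\<^sub>R outer x x"
    by (simp add: vec_eq_iff)
  ultimately show ?thesis
    using that \<open>b \<noteq> 0\<close> unfolding b_def by blast
qed

section \<open>The Veronese surface: equations, orbit, and the double eigenvalue\<close>

definition veronese :: "real \<Rightarrow> real \<Rightarrow> (real ^ 3 ^ 3) set" where
  "veronese a b = {mat a + b *\<^sub>R outer x x | x. norm x = 1}"

text \<open>The minors alone describe a cone with apex \<open>mat a\<close>, of rank-one
  perturbations of every size and sign. The trace fixes the size \<open>b\<close>, and
  \<open>b \<noteq> 0\<close> keeps the apex out.\<close>

lemma in_veronese_iff:
  assumes "b \<noteq> 0"
  shows "X \<in> veronese a b \<longleftrightarrow> X \<in> Sym3 \<and> trace X = 3 * a + b \<and>
    (\<forall>i j k l. (X - mat a) $ i $ j * (X - mat a) $ k $ l = (X - mat a) $ i $ l * (X - mat a) $ k $ j)"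
    (is "_ \<longleftrightarrow> ?R")
proof
  assume "X \<in> veronese a b"
  then obtain x where x: "norm x = 1" "X = mat a + b *\<^sub>R outer x x"
    by (auto simp: veronese_def)
  have "x \<bullet> x = 1"
    using x by (simp add: norm_eq_1)
  then have "b * (x $ 1 * x $ 1) + (b * (x $ 2 * x $ 2) + b * (x $ 3 * x $ 3)) = b"
    by (simp add: inner_vec_def sum_3 flip: distrib_left)
  then show ?R
    using x by (auto simp: Sym3_def trace_def transpose_def vec_eq_iff mat_def sum_3)
next
  assume R: ?R
  have tr: "trace (X - mat a) = b"
    using R by (simp add: trace_def sum_3 mat_def)
  moreover have "transpose (X - mat a) = X - mat a"
    using R by (simp add: Sym3_def transpose_def vec_eq_iff mat_def)
  moreover have "X - mat a \<noteq> 0"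
    using tr assms by (auto simp: trace_def)
  ultimately obtain x where "norm x = 1" "X - mat a = b *\<^sub>R outer x x"
    using symmetric_rank_one[of "X - mat a"] R by metis
  then show "X \<in> veronese a b"
    unfolding veronese_def by (smt (verit) add.commute diff_add_cancel mem_Collect_eq)
qed

lemma algebraic_veronese:
  assumes "b \<noteq> 0"
  shows "algebraic_in_Sym3 (veronese a b)"
proof -
  define m where "m = (\<lambda>(i,j,k,l) X. (X - mat a) $ i $ j * (X - mat a) $ k $ l
    - (X - mat a) $ i $ l * (X - mat a :: real^3^3) $ k $ j)"
  define t :: "real^3^3 \<Rightarrow> real" where "t = (\<lambda>X. (\<Sum>i\<in>UNIV. X $ i $ i) - (3 * a + b))"
  have entry: "real_polynomial_function (\<lambda>X::real^3^3. X $ i $ j)" for i j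
    by (intro real_polynomial_function.intros(1) bounded_linear_compose[OF bounded_linear_vec_nth
        bounded_linear_vec_nth])
  have "real_polynomial_function (m p)" for p
    by (cases p) (auto simp: m_def intro!: entry real_polynomial_function_diff
        real_polynomial_function.intros(2,4))
  moreover have "real_polynomial_function t"
    by (auto simp: t_def intro!: entry real_polynomial_function_diff real_polynomial_function_sum
        real_polynomial_function.intros(2))
  moreover have "X \<in> veronese a b \<longleftrightarrow> X \<in> Sym3 \<and> (\<forall>p\<in>insert t (range m). p X = 0)" for X
    using in_veronese_iff[OF assms, of X a] by (auto simp: m_def t_def trace_def)
  \<comment> \<open>There are finitely many equations because the index quadruples form a finite
    type.\<close>
  ultimately show ?thesis
    unfolding algebraic_in_Sym3_def
    by (intro exI[of _ "insert t (range m)"]) auto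
qed

text \<open>Conjugation by a rotation fixes \<open>mat a\<close> and moves \<open>e\<close> to
  \<open>g *v e\<close>; rotations act transitively on unit vectors.\<close>

lemma SO3_orbit_rank_one:
  assumes "norm e = 1"
  shows "SO3_orbit (mat a + b *\<^sub>R outer e e) = veronese a b"
proof -
  have conj: "g ** (mat a + b *\<^sub>R outer e e) ** transpose g
      = mat a + b *\<^sub>R outer (g *v e) (g *v e)" if "rotation_matrix g" for g
  proof -
    have "g ** transpose g = mat 1"
      using that by (simp add: rotation_matrix_def orthogonal_matrix_def)
    moreover have "g ** mat a = a *\<^sub>R g"
      by (simp add: vec_eq_iff matrix_matrix_mult_def mat_def if_distrib cong: if_cong)
    moreover have "a *\<^sub>R mat 1 = (mat a :: real^3^3)"
      by (simp add: vec_eq_iff mat_def)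
    moreover have "(B + C) ** h = B ** h + C ** h" for B C h :: "real^3^3"
      by (simp add: vec_eq_iff matrix_matrix_mult_def sum.distrib distrib_right)
    moreover have "(c *\<^sub>R B) ** h = c *\<^sub>R (B ** h)" "B ** (c *\<^sub>R h) = c *\<^sub>R (B ** h)"
      for B h :: "real^3^3" and c
      by (simp_all add: vec_eq_iff matrix_matrix_mult_def sum_distrib_left ac_simps)
    ultimately show ?thesis
      by (simp add: matrix_add_ldistrib conjugate_outer)
  qed
  have "\<exists>g. rotation_matrix g \<and> g *v e = x" if x: "norm x = 1" for x
  proof -
    obtain f where f: "orthogonal_transformation f" "det (matrix f) = 1" "f e = x"
      using rotation_exists_1[of e x] assms x by auto
    then have "rotation_matrix (matrix f)" "matrix f *v e = x"
      by (simp_all add: rotation_matrix_def orthogonal_transformation_matrix matrix_works)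
    then show ?thesis
      by blast
  qed
  moreover have "norm (g *v e) = 1" if "rotation_matrix g" for g
    using that assms orthogonal_transformation_norm[of "(*v) g" e]
    by (simp add: rotation_matrix_def orthogonal_transformation_matrix)
  ultimately show ?thesis
    unfolding SO3_orbit_def veronese_def using conj by (auto; metis)
qed

text \<open>For a symmetric matrix, the squares of the entries of its adjugate sum to
  (trace of the adjugate)^2 up to a multiple of the determinant. So if 0 is a double root of the
  characteristic polynomial, then all 2 x 2 minors vanish.\<close>

lemma symmetric_minors_vanish:
  fixes p q r u s w :: real
  assumes det: "p * q * r + 2 * u * s * w - p * w^2 - q * s^2 - r * u^2 = 0"
    and minors: "(p * q - u^2) + (p * r - s^2) + (q * r - w^2) = 0"
  shows "p * q = u^2" "p * r = s^2" "q * r = w^2" "u * s = p * w" "u * w = q * s" "s * w = r * u"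
proof -
  have "(p * q - u^2)^2 + (p * r - s^2)^2 + (q * r - w^2)^2
      + 2 * (u * s - p * w)^2 + 2 * (u * w - q * s)^2 + 2 * (s * w - r * u)^2
      = ((p * q - u^2) + (p * r - s^2) + (q * r - w^2))^2
        - 2 * (p + q + r) * (p * q * r + 2 * u * s * w - p * w^2 - q * s^2 - r * u^2)"
    by algebra
  also have "\<dots> = 0"
    using assms by simp
  finally have sum: "(p * q - u^2)^2 + (p * r - s^2)^2 + (q * r - w^2)^2
      + 2 * (u * s - p * w)^2 + 2 * (u * w - q * s)^2 + 2 * (s * w - r * u)^2 = 0" .
  have nonneg: "(p * q - u^2)^2 \<ge> 0" "(p * r - s^2)^2 \<ge> 0" "(q * r - w^2)^2 \<ge> 0"
    "(u * s - p * w)^2 \<ge> 0" "(u * w - q * s)^2 \<ge> 0" "(s * w - r * u)^2 \<ge> 0"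
    by simp_all
  have "(p * q - u^2)^2 = 0" "(p * r - s^2)^2 = 0" "(q * r - w^2)^2 = 0"
    "(u * s - p * w)^2 = 0" "(u * w - q * s)^2 = 0" "(s * w - r * u)^2 = 0"
    using sum nonneg by linarith+
  then show "p * q = u^2" "p * r = s^2" "q * r = w^2" "u * s = p * w" "u * w = q * s" "s * w = r * u"
    by simp_all
qed

text \<open>At a double root both the characteristic polynomial and its derivative vanish. Their
  values at \<open>a\<close> are, up to sign, the determinant of \<open>A - mat a\<close> and the
  sum of its principal 2 x 2 minors, the two quantities that the preceding lemma needs.\<close>

lemma double_eigenvalue_minors:
  assumes "A \<in> Sym3" and "order a (charpoly A) \<ge> 2"
  shows "\<forall>i j k l. (A - mat a) $ i $ j * (A - mat a) $ k $ l = (A - mat a) $ i $ l * (A - mat a) $ k $ j"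
proof -
  have sym: "A $ 2 $ 1 = A $ 1 $ 2" "A $ 3 $ 1 = A $ 1 $ 3" "A $ 3 $ 2 = A $ 2 $ 3"
    using assms by (auto simp: Sym3_def transpose_def vec_eq_iff)
  have "[:-a, 1:]^2 dvd charpoly A"
    using assms order_divides by blast
  then obtain c where c: "charpoly A = [:-a, 1:]^2 * c"
    by blast
  have "poly (charpoly A) a = 0" "poly (pderiv (charpoly A)) a = 0"
    unfolding c power2_eq_square
    by (simp_all add: pderiv_mult pderiv_pCons del: mult_pCons_left mult_pCons_right)
  moreover define p q r u s w where pqr: "p = A $ 1 $ 1 - a" "q = A $ 2 $ 2 - a" "r = A $ 3 $ 3 - a"
    "u = A $ 1 $ 2" "s = A $ 1 $ 3" "w = A $ 2 $ 3"
  ultimately have "p * q * r + 2 * u * s * w - p * w^2 - q * s^2 - r * u^2 = 0"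
    "(p * q - u^2) + (p * r - s^2) + (q * r - w^2) = 0"
    using sym
    by (simp_all add: charpoly_def det_3 pderiv_mult pderiv_pCons pderiv_diff pderiv_add pderiv_minus)
       (auto simp: algebra_simps power2_eq_square)
  note minors = symmetric_minors_vanish[OF this]
  show ?thesis
    unfolding forall_3 using minors sym by (simp add: pqr mat_def power2_eq_square algebra_simps)
qed

lemma double_eigenvalue_decomposition:
  assumes "A \<in> Sym3" "\<not> scalar_matrix A" "has_multiple_eigenvalue A"
  obtains a b e where "b \<noteq> 0" "norm e = 1" "A = mat a + b *\<^sub>R outer e e"
proof -
  obtain a where a: "order a (charpoly A) \<ge> 2"
    using assms by (auto simp: has_multiple_eigenvalue_def)
  have "transpose (A - mat a) = A - mat a"
    using assms by (simp add: Sym3_def transpose_def vec_eq_iff mat_def)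
  moreover have "A - mat a \<noteq> 0"
    using assms by (auto simp: scalar_matrix_def)
  ultimately obtain x where x: "trace (A - mat a) \<noteq> 0" "norm x = 1"
      "A - mat a = trace (A - mat a) *\<^sub>R outer x x"
    using double_eigenvalue_minors[OF assms(1) a] by (rule symmetric_rank_one)
  then have "A = mat a + trace (A - mat a) *\<^sub>R outer x x"
    by (metis add.commute diff_add_cancel)
  with x that show ?thesis
    by blast
qed

section \<open>The orbit as a projective plane\<close>

text \<open>The second term is \<open>b\<close> times the orthogonal projection onto the line of
  \<open>x\<close>.\<close>

definition line_pt :: "real \<Rightarrow> real \<Rightarrow> real ^ 3 \<Rightarrow> real ^ 3 ^ 3" where
  "line_pt a b x = mat a + (b / (x \<bullet> x)) *\<^sub>R outer x x"

lemma line_pt_scaleR: "k \<noteq> 0 \<Longrightarrow> line_pt a b (k *\<^sub>R x) = line_pt a b x"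
  by (simp add: line_pt_def vec_eq_iff field_simps)

lemma veronese_eq_line_pt: "veronese a b = line_pt a b ` (- {0})"
proof (intro equalityI subsetI)
  fix X assume "X \<in> veronese a b"
  then obtain x where "norm x = 1" "X = mat a + b *\<^sub>R outer x x"
    by (auto simp: veronese_def)
  then have "x \<noteq> 0" "X = line_pt a b x"
    by (auto simp: line_pt_def norm_eq_1)
  then show "X \<in> line_pt a b ` (- {0})"
    by simp
next
  fix X assume "X \<in> line_pt a b ` (- {0})"
  then obtain x where x: "x \<noteq> 0" "X = line_pt a b x"
    by blast
  then have "X = line_pt a b ((1 / norm x) *\<^sub>R x)"
    by (simp add: line_pt_scaleR)
  moreover have "norm ((1 / norm x) *\<^sub>R x) = 1"
    using x by simp
  then have "line_pt a b ((1 / norm x) *\<^sub>R x) = mat a + b *\<^sub>R outer ((1 / norm x) *\<^sub>R x) ((1 / norm x) *\<^sub>R x)"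
    unfolding line_pt_def norm_eq_1 by simp
  ultimately show "X \<in> veronese a b"
    using \<open>norm ((1 / norm x) *\<^sub>R x) = 1\<close> unfolding veronese_def by blast
qed

definition eigenline :: "real \<Rightarrow> real \<Rightarrow> real ^ 3 ^ 3 \<Rightarrow> (real ^ 3) set" where
  "eigenline a b X = {v. (X - mat a) *v v = b *\<^sub>R v}"

text \<open>\<open>line_pt a b x - mat a\<close> is \<open>b\<close> times the projection onto the
  line of \<open>x\<close>, and a projection fixes exactly the vectors of its range.\<close>

lemma eigenline_line_pt:
  assumes "b \<noteq> 0" "x \<noteq> 0"
  shows "eigenline a b (line_pt a b x) = span {x}"
proof -
  have "(line_pt a b x - mat a) *v v = (b / (x \<bullet> x) * (x \<bullet> v)) *\<^sub>R x" for v
    by (simp add: line_pt_def scaleR_matrix_vector_assoc[symmetric] outer_mult_vec)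
  moreover have "(b / (x \<bullet> x) * (x \<bullet> v)) *\<^sub>R x = b *\<^sub>R v \<longleftrightarrow> (\<exists>k. v = k *\<^sub>R x)" for v
  proof
    assume "(b / (x \<bullet> x) * (x \<bullet> v)) *\<^sub>R x = b *\<^sub>R v"
    then have "b *\<^sub>R (((x \<bullet> v) / (x \<bullet> x)) *\<^sub>R x) = b *\<^sub>R v"
      by simp
    then show "\<exists>k. v = k *\<^sub>R x"
      using assms by (metis scaleR_cancel_left)
  qed (use assms in auto)
  ultimately show ?thesis
    by (auto simp: eigenline_def span_singleton)
qed

lemma topspace_RP2: "topspace RP2_topology = RP2"
proof -
  have "{x. x \<noteq> 0 \<and> span {x} \<in> RP2} = - {0}"
    by (auto simp: RP2_def)
  then have "openin RP2_topology RP2"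
    by (simp add: openin_RP2_topology open_Compl)
  then show ?thesis
    by (metis openin_RP2_topology openin_subset openin_topspace subset_antisym)
qed

lemma bij_betw_eigenline:
  assumes "b \<noteq> 0"
  shows "bij_betw (eigenline a b) (veronese a b) RP2"
  unfolding bij_betw_def
proof
  show "inj_on (eigenline a b) (veronese a b)"
  proof (rule inj_onI)
    fix X Y assume "X \<in> veronese a b" "Y \<in> veronese a b" and eq: "eigenline a b X = eigenline a b Y"
    then obtain x y where xy: "x \<noteq> 0" "X = line_pt a b x" "y \<noteq> 0" "Y = line_pt a b y"
      by (auto simp: veronese_eq_line_pt)
    then have "span {x} = span {y}"
      using eq assms by (simp add: eigenline_line_pt)
    then have "x \<in> span {y}"
      by (metis span_base singletonI)
    then obtain k where "x = k *\<^sub>R y"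
      by (auto simp: span_singleton)
    with xy show "X = Y"
      by (metis line_pt_scaleR scaleR_zero_left)
  qed
  have "eigenline a b ` veronese a b = (\<lambda>x. span {x}) ` (- {0})"
    unfolding veronese_eq_line_pt image_image
    by (rule image_cong) (use assms in \<open>auto simp: eigenline_line_pt\<close>)
  then show "eigenline a b ` veronese a b = RP2"
    by (auto simp: RP2_def)
qed

lemma line_pt_nth:
  assumes "b \<noteq> 0" "x \<noteq> 0"
  shows "(line_pt a b x - mat a) $ i $ j = b / (x \<bullet> x) * (x $ i * x $ j)"
    and "line_pt a b x $ i $ i \<noteq> a \<longleftrightarrow> x $ i \<noteq> 0"
  using assms by (auto simp: line_pt_def mat_def)

text \<open>For \<open>X = line_pt a b x\<close> this column is
  \<open>b / (x \<bullet> x) * x $ i\<close> times \<open>x\<close>, and the factor vanishes only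
  with \<open>x $ i\<close>.\<close>

lemma eigenline_column:
  assumes "b \<noteq> 0" "X \<in> veronese a b" "X $ i $ i \<noteq> a"
  shows "column i (X - mat a) \<noteq> 0" "span {column i (X - mat a)} = eigenline a b X"
proof -
  obtain x where x: "x \<noteq> 0" "X = line_pt a b x"
    using assms by (auto simp: veronese_eq_line_pt)
  define k where "k = b / (x \<bullet> x) * x $ i"
  have "column i (X - mat a) = k *\<^sub>R x"
    unfolding x(2) column_def using line_pt_nth(1)[OF assms(1) x(1)] by (simp add: vec_eq_iff k_def)
  moreover have "k \<noteq> 0"
    using assms x line_pt_nth(2) by (simp add: k_def)
  ultimately show "column i (X - mat a) \<noteq> 0" "span {column i (X - mat a)} = eigenline a b X"
    using x assms span_image_scale[of "{x}" "\<lambda>_. k"] by (auto simp: eigenline_line_pt)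
qed

lemma veronese_diag:
  assumes "b \<noteq> 0" "X \<in> veronese a b"
  obtains i where "X $ i $ i \<noteq> a"
proof -
  obtain x where x: "x \<noteq> 0" "X = line_pt a b x"
    using assms by (auto simp: veronese_eq_line_pt)
  then obtain i where "x $ i \<noteq> 0"
    by (auto simp: vec_eq_iff)
  with that show ?thesis
    using x assms line_pt_nth(2) by blast
qed

lemma continuous_on_line_pt: "continuous_on (- {0}) (line_pt a b)"
  unfolding line_pt_def
  by (intro continuous_intros bounded_bilinear.continuous_on[OF bounded_bilinear_outer]) auto

text \<open>The column of \<open>X - mat a\<close> through a nonzero diagonal entry is a continuous choice of a
  spanning vector of the line of \<open>X\<close>, which makes \<open>eigenline\<close> continuous; conversely a set of lines
  is open as soon as its preimage under the continuous map \<open>line_pt\<close> is.\<close>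

lemma homeomorphic_map_eigenline:
  assumes "b \<noteq> 0"
  shows "homeomorphic_map (top_of_set (veronese a b)) RP2_topology (eigenline a b)"
proof (rule bijective_open_imp_homeomorphic_map)
  note bij = bij_betw_eigenline[OF assms, of a]
  show "continuous_map (top_of_set (veronese a b)) RP2_topology (eigenline a b)"
    unfolding continuous_map_def
  proof (intro conjI allI impI)
    show "eigenline a b \<in> topspace (top_of_set (veronese a b)) \<rightarrow> topspace RP2_topology"
      using bij by (auto simp: bij_betw_def topspace_RP2)
    fix V assume "openin RP2_topology V"
    then have W: "open {x. x \<noteq> 0 \<and> span {x} \<in> V}" (is "open ?W")
      by (simp add: openin_RP2_topology)
    have "continuous_on UNIV (\<lambda>X::real^3^3. column i (X - mat a))" for i
      unfolding column_def by (intro continuous_intros)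
    then have op: "open ({X::real^3^3. X $ i $ i \<noteq> a} \<inter> (\<lambda>X. column i (X - mat a)) -` ?W)" for i
      using W by (intro open_Int open_Collect_neq open_vimage continuous_intros)
    have "{X \<in> veronese a b. eigenline a b X \<in> V}
        = veronese a b \<inter> (\<Union>i. {X. X $ i $ i \<noteq> a} \<inter> (\<lambda>X. column i (X - mat a)) -` ?W)"
      using eigenline_column[OF assms] veronese_diag[OF assms] by (auto; metis)
    then show "openin (top_of_set (veronese a b)) {X \<in> topspace (top_of_set (veronese a b)). eigenline a b X \<in> V}"
      unfolding openin_open topspace_euclidean_subtopology using op
      by (intro exI[of _ "\<Union>i. {X. X $ i $ i \<noteq> a} \<inter> (\<lambda>X. column i (X - mat a)) -` ?W"]) auto
  qed
  show "open_map (top_of_set (veronese a b)) RP2_topology (eigenline a b)"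
    unfolding open_map_def
  proof (intro allI impI)
    fix U assume "openin (top_of_set (veronese a b)) U"
    then obtain T where T: "open T" "U = veronese a b \<inter> T"
      by (auto simp: openin_open)
    have "span {x} \<in> eigenline a b ` U \<longleftrightarrow> line_pt a b x \<in> T" if "x \<noteq> 0" for x
    proof -
      have "line_pt a b x \<in> veronese a b"
        using that by (auto simp: veronese_eq_line_pt)
      then show ?thesis
        using eigenline_line_pt[OF assms that, of a] bij inj_on_image_mem_iff[of "eigenline a b" "veronese a b" "line_pt a b x" U] T
        by (auto simp: bij_betw_def)
    qed
    then have "{x. x \<noteq> 0 \<and> span {x} \<in> eigenline a b ` U} = - {0} \<inter> line_pt a b -` T"
      by auto
    moreover have "open (- {0} \<inter> line_pt a b -` T)"
      using T continuous_on_line_pt by (intro continuous_open_preimage) auto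
    moreover have "eigenline a b ` U \<subseteq> RP2"
      using bij T by (auto simp: bij_betw_def)
    ultimately show "openin RP2_topology (eigenline a b ` U)"
      by (simp add: openin_RP2_topology)
  qed
qed (use bij_betw_eigenline[OF assms, of a] in \<open>auto simp: bij_betw_def topspace_RP2\<close>)

section \<open>Affine charts on the orbit\<close>

lemma forall_3_shift: "(\<forall>j::3. P j) \<longleftrightarrow> P i \<and> P (i + 1) \<and> P (i + 2)"
proof -
  \<comment> \<open>For \<open>i\<close> equal to 2 or 3 the shifts produce the numerals 4 and 5,
    which have to be reduced modulo 3.\<close>
  have mod3: "(4::3) = 1" "(5::3) = 2"
    by simp_all
  show ?thesis
    using exhaust_3[of i] by (auto simp: forall_3 mod3)
qed

lemma index_3_shift: "i + 1 \<noteq> i" "i + 2 \<noteq> i" "i + 2 \<noteq> i + 1" for i :: 3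
  using exhaust_3[of i] by auto

text \<open>This is the representative, with coordinate \<open>i\<close> equal to 1, of the line
  with affine coordinates \<open>y\<close>. It is written as a constant plus a linear map, the form
  in which its smoothness is read off.\<close>

definition affine_pt :: "3 \<Rightarrow> real ^ 2 \<Rightarrow> real ^ 3" where
  "affine_pt i y = axis i 1 + (y $ 1 *\<^sub>R axis (i + 1) 1 + y $ 2 *\<^sub>R axis (i + 2) 1)"

lemma affine_pt_nth: "affine_pt i y $ i = 1" "affine_pt i y $ (i + 1) = y $ 1"
  "affine_pt i y $ (i + 2) = y $ 2"
  using index_3_shift[of i] by (auto simp: affine_pt_def axis_def)

lemma affine_pt_nonzero: "affine_pt i y \<noteq> 0"
  using affine_pt_nth(1)[of i y] by auto

definition orbit_chart_dom :: "real \<Rightarrow> real \<Rightarrow> 3 \<Rightarrow> (real ^ 3 ^ 3) set" where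
  "orbit_chart_dom a b i = {X \<in> veronese a b. X $ i $ i \<noteq> a}"

text \<open>With \<open>X = line_pt a b x\<close> the common factor
  \<open>b * x $ i / (x \<bullet> x)\<close> cancels and the affine coordinates of \<open>x\<close>
  remain. Only the diagonal entry needs \<open>a\<close> subtracted. The formula is smooth on the
  whole open set \<open>X $ i $ i \<noteq> a\<close> of matrices.\<close>

definition orbit_chart :: "real \<Rightarrow> 3 \<Rightarrow> real ^ 3 ^ 3 \<Rightarrow> real ^ 2" where
  "orbit_chart a i X = inverse (X $ i $ i - a) *\<^sub>R vector [X $ i $ (i + 1), X $ i $ (i + 2)]"

lemma orbit_chart_line_pt:
  assumes "b \<noteq> 0" "x $ i \<noteq> 0"
  shows "orbit_chart a i (line_pt a b x) = vector [x $ (i + 1) / x $ i, x $ (i + 2) / x $ i]"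
proof -
  have "x \<noteq> 0"
    using assms by auto
  then show ?thesis
    using assms index_3_shift[of i]
    by (simp add: orbit_chart_def line_pt_def mat_def vec_eq_iff forall_2)
qed

lemma orbit_chart_dom_eq:
  assumes "b \<noteq> 0"
  shows "orbit_chart_dom a b i = line_pt a b ` {x. x $ i \<noteq> 0}"
proof (intro equalityI subsetI)
  fix X assume "X \<in> orbit_chart_dom a b i"
  then obtain x where x: "x \<noteq> 0" "X = line_pt a b x" "X $ i $ i \<noteq> a"
    by (auto simp: orbit_chart_dom_def veronese_eq_line_pt)
  with assms have "x $ i \<noteq> 0"
    using line_pt_nth(2) by blast
  with x show "X \<in> line_pt a b ` {x. x $ i \<noteq> 0}"
    by blast
next
  fix X assume "X \<in> line_pt a b ` {x. x $ i \<noteq> 0}"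
  then obtain x where x: "x $ i \<noteq> 0" "X = line_pt a b x"
    by blast
  then have "x \<noteq> 0"
    by auto
  with x assms show "X \<in> orbit_chart_dom a b i"
    using line_pt_nth(2) by (auto simp: orbit_chart_dom_def veronese_eq_line_pt)
qed

lemma line_pt_affine_pt_orbit_chart:
  assumes "b \<noteq> 0" "X \<in> orbit_chart_dom a b i"
  shows "line_pt a b (affine_pt i (orbit_chart a i X)) = X"
proof -
  obtain x where x: "x $ i \<noteq> 0" "X = line_pt a b x"
    using assms by (auto simp: orbit_chart_dom_eq)
  have "affine_pt i (vector [x $ (i + 1) / x $ i, x $ (i + 2) / x $ i]) = (1 / x $ i) *\<^sub>R x"
    unfolding vec_eq_iff forall_3_shift[of _ i] using x by (simp add: affine_pt_nth)
  then show ?thesis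
    using x assms by (simp add: orbit_chart_line_pt line_pt_scaleR)
qed

lemma orbit_chart_affine_pt:
  assumes "b \<noteq> 0"
  shows "orbit_chart a i (line_pt a b (affine_pt i y)) = y"
  using orbit_chart_line_pt[OF assms, of "affine_pt i y" i a]
  by (simp add: affine_pt_nth vec_eq_iff forall_2)

lemma line_pt_affine_pt_in_dom: "b \<noteq> 0 \<Longrightarrow> line_pt a b (affine_pt i y) \<in> orbit_chart_dom a b i"
  by (auto simp: orbit_chart_dom_eq affine_pt_nth)

lemma smooth_orbit_chart: "smooth_on (orbit_chart_dom a b i) (orbit_chart a i)"
proof (rule smooth_on_subset)
  let ?W = "{X :: real^3^3. X $ i $ i \<noteq> a}"
  have nth: "Ck_on k ?W (\<lambda>X. X $ i $ j)" for k j
    by (intro Ck_on_bounded_linear bounded_linear_compose[OF bounded_linear_vec_nth bounded_linear_vec_nth])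
  have "linear (\<lambda>X::real^3^3. vector [X $ i $ (i + 1), X $ i $ (i + 2)] :: real^2)"
    by (auto intro!: linearI simp: vec_eq_iff forall_2)
  then have "Ck_on k ?W (\<lambda>X. vector [X $ i $ (i + 1), X $ i $ (i + 2)] :: real^2)" for k
    by (intro Ck_on_bounded_linear linear_conv_bounded_linear[THEN iffD1])
  moreover have "Ck_on k ?W (\<lambda>X. inverse (X $ i $ i + - a))" for k
    by (intro Ck_on_inverse Ck_on_add nth Ck_on_const) auto
  ultimately have "Ck_on k ?W (orbit_chart a i)" for k
    unfolding orbit_chart_def by (intro Ck_on_bilinear[OF bounded_bilinear_scaleR]) simp_all
  then show "smooth_on ?W (orbit_chart a i)"
    by (intro smooth_on_open open_Collect_neq continuous_intros)
qed (auto simp: orbit_chart_dom_def)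

text \<open>Needed along two nowhere vanishing maps: \<open>affine_pt i\<close> for the inverse
  charts, and the moving direction \<open>h\<close> for the circles.\<close>

lemma Ck_on_line_pt:
  assumes f: "Ck_on k W f" and "\<And>t. t \<in> W \<Longrightarrow> f t \<noteq> 0"
  shows "Ck_on k W (\<lambda>t. line_pt a b (f t))"
  unfolding line_pt_def divide_inverse using assms
  by (intro Ck_on_add Ck_on_const Ck_on_bilinear[OF bounded_bilinear_scaleR]
      Ck_on_bilinear[OF bounded_bilinear_outer] Ck_on_bilinear[OF bounded_bilinear_mult]
      Ck_on_inverse Ck_on_bilinear[OF bounded_bilinear_inner]) auto

lemma orbit_chart_in_submanifold_atlas:
  assumes "b \<noteq> 0"
  shows "(orbit_chart_dom a b i, orbit_chart a i) \<in> submanifold_atlas (veronese a b)"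
proof -
  let ?D = "orbit_chart_dom a b i" and ?\<phi> = "orbit_chart a i"
  have inv: "line_pt a b (affine_pt i (?\<phi> X)) = X" if "X \<in> ?D" for X
    using line_pt_affine_pt_orbit_chart[OF assms that] .
  have inj: "inj_on ?\<phi> ?D"
    using inv by (rule inj_on_inverseI)
  have im: "?\<phi> ` ?D = UNIV"
    using orbit_chart_affine_pt[OF assms] line_pt_affine_pt_in_dom[OF assms] by (metis surj_def image_eqI UNIV_eq_I)
  have "?D = veronese a b \<inter> {X. X $ i $ i \<noteq> a}"
    by (auto simp: orbit_chart_dom_def)
  moreover have "open {X :: real^3^3. X $ i $ i \<noteq> a}"
    by (intro open_Collect_neq continuous_intros)
  ultimately have "openin (top_of_set (veronese a b)) ?D"
    by (auto simp: openin_open)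
  moreover have "linear (\<lambda>y::real^2. y $ 1 *\<^sub>R axis (i + 1) 1 + y $ 2 *\<^sub>R axis (i + 2) 1 :: real^3)"
    by (auto intro!: linearI simp: algebra_simps)
  then have "Ck_on k UNIV (affine_pt i)" for k
    unfolding affine_pt_def
    by (intro Ck_on_add[OF Ck_on_const] Ck_on_bounded_linear linear_conv_bounded_linear[THEN iffD1])
  then have "smooth_on UNIV (\<lambda>y. line_pt a b (affine_pt i y))"
    using affine_pt_nonzero by (intro smooth_on_open Ck_on_line_pt) auto
  then have "smooth_on UNIV (inv_into ?D ?\<phi>)"
  proof (rule smooth_on_cong)
    fix y
    show "line_pt a b (affine_pt i y) = inv_into ?D ?\<phi> y"
      using inv_into_f_f[OF inj line_pt_affine_pt_in_dom[OF assms], of y] orbit_chart_affine_pt[OF assms]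
      by simp
  qed
  ultimately show ?thesis
    using inj smooth_orbit_chart by (simp add: submanifold_atlas_def im)
qed

lemma RP2_chart_dom:
  assumes "b \<noteq> 0"
  shows "fst (RP2_chart i) = eigenline a b ` orbit_chart_dom a b i"
proof -
  have "fst (RP2_chart i) = (\<lambda>x. span {x}) ` {x. x $ i \<noteq> 0}"
    by (auto simp: RP2_chart_def RP2_def span_singleton image_iff)
  also have "\<dots> = eigenline a b ` orbit_chart_dom a b i"
    unfolding orbit_chart_dom_eq[OF assms] image_image
  proof (rule image_cong)
    fix x :: "real^3" assume "x \<in> {x. x $ i \<noteq> 0}"
    then have "x \<noteq> 0"
      by auto
    then show "span {x} = eigenline a b (line_pt a b x)"
      using assms by (simp add: eigenline_line_pt)
  qed simp
  finally show ?thesis .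
qed

text \<open>Both charts return the quotients of the coordinates of \<open>x\<close> by
  \<open>x $ i\<close>. This is the matching of charts that the transport lemma asks for.\<close>

lemma RP2_chart_eigenline:
  assumes "b \<noteq> 0" "X \<in> orbit_chart_dom a b i"
  shows "snd (RP2_chart i) (eigenline a b X) = orbit_chart a i X"
proof -
  obtain x where x: "x $ i \<noteq> 0" "X = line_pt a b x"
    using assms by (auto simp: orbit_chart_dom_eq)
  then have "x \<noteq> 0"
    by auto
  with x assms show ?thesis
    by (simp add: eigenline_line_pt RP2_chart_span orbit_chart_line_pt)
qed

lemma Union_RP2_atlas: "\<Union> (fst ` RP2_atlas) = topspace RP2_topology"
proof -
  have "\<exists>i. \<exists>y\<in>span {x}. y $ i \<noteq> 0" if "x \<noteq> 0" for x :: "real^3"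
    using that by (metis singletonI span_base vec_eq_iff zero_index)
  then show ?thesis
    unfolding topspace_RP2 by (auto simp: RP2_atlas_def RP2_chart_def RP2_def)
qed

theorem veronese_diffeomorphic_RP2:
  assumes "b \<noteq> 0"
  shows "diffeomorphic (top_of_set (veronese a b)) (submanifold_atlas (veronese a b)) RP2_topology RP2_atlas"
proof (rule diffeomorphic_submanifold_transport[OF homeomorphic_map_eigenline[OF assms] Union_RP2_atlas])
  fix V \<psi> assume "(V, \<psi>) \<in> RP2_atlas"
  then obtain i where i: "V = fst (RP2_chart i)" "\<psi> = snd (RP2_chart i)"
    unfolding RP2_atlas_def by (metis fst_conv rangeE snd_conv)
  show "\<exists>D \<phi>. (D, \<phi>) \<in> submanifold_atlas (veronese a b) \<and> V = eigenline a b ` D \<and>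
      (\<forall>x\<in>D. \<psi> (eigenline a b x) = \<phi> x)"
    unfolding i using orbit_chart_in_submanifold_atlas[OF assms] RP2_chart_dom[OF assms]
      RP2_chart_eigenline[OF assms] by blast
qed

section \<open>The sphere and the affine hull of the orbit\<close>

definition traceless :: "(real ^ 3 ^ 3) set" where
  "traceless = {X \<in> Sym3. trace X = 0}"

lemma subspace_traceless: "subspace traceless"
  by (auto simp: traceless_def subspace_def Sym3_def transpose_def trace_def vec_eq_iff sum.distrib
      simp flip: sum_distrib_left)

lemma traceless_nth:
  assumes "X \<in> traceless"
  shows "X $ 2 $ 1 = X $ 1 $ 2" "X $ 3 $ 1 = X $ 1 $ 3" "X $ 3 $ 2 = X $ 2 $ 3"
    "X $ 3 $ 3 = - X $ 1 $ 1 - X $ 2 $ 2"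
  using assms symmetric_nth[of X 2 1] symmetric_nth[of X 3 1] symmetric_nth[of X 3 2]
  by (simp_all add: traceless_def Sym3_def trace_def sum_3)

text \<open>Two diagonal and three off-diagonal entries are free; \<open>m\<close> makes this an
  isomorphism from a space of dimension 2 + 3.\<close>

lemma dim_traceless: "dim traceless = 5"
proof -
  define m :: "(real ^ 2) \<times> (real ^ 3) \<Rightarrow> real ^ 3 ^ 3" where
    "m = (\<lambda>(d, z). vector [vector [d $ 1, z $ 1, z $ 2], vector [z $ 1, d $ 2, z $ 3],
      vector [z $ 2, z $ 3, - d $ 1 - d $ 2]])"
  have "linear m"
    by (auto intro!: linearI simp: m_def vec_eq_iff forall_3 algebra_simps)
  moreover have "inj m"
    by (auto simp: inj_def m_def vec_eq_iff forall_3 forall_2)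
  moreover have "m p \<in> traceless" for p
    by (auto simp: m_def traceless_def Sym3_def transpose_def trace_def vec_eq_iff forall_3 sum_3 split: prod.split)
  moreover have "\<exists>p. X = m p" if "X \<in> traceless" for X
    by (intro exI[of _ "(vector [X $ 1 $ 1, X $ 2 $ 2], vector [X $ 1 $ 2, X $ 1 $ 3, X $ 2 $ 3])"])
      (simp add: m_def vec_eq_iff forall_3 traceless_nth[OF that])
  ultimately have "traceless = range m"
    by blast
  then show ?thesis
    using dim_image_eq[OF \<open>linear m\<close>, of UNIV] \<open>inj m\<close> by simp
qed

lemma line_pt_minus_centre: "line_pt a b x - mat (a + b / 3) = (b / (x \<bullet> x)) *\<^sub>R (outer x x - mat ((x \<bullet> x) / 3))"
  if "x \<noteq> 0"
  using that by (simp add: line_pt_def vec_eq_iff mat_def field_simps)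

lemma veronese_in_sphere:
  assumes "b \<noteq> 0"
  shows "\<exists>S. round_sphere 4 S \<and> S \<subseteq> Sym3 \<and> veronese a b \<subseteq> S"
proof (intro exI conjI)
  \<comment> \<open>The centre is the scalar matrix with the common trace \<open>3 * a + b\<close>
    of the orbit. For a unit vector \<open>x\<close>, subtracting a third of the identity from
    \<open>outer x x\<close> leaves squared norm 1 - 2/3 + 1/3 = 2/3, whence the radius.\<close>
  let ?c = "mat (a + b / 3) :: real^3^3" and ?r = "\<bar>b\<bar> * sqrt (2 / 3)"
  let ?L = "(+) ?c ` traceless"
  have "affine ?L"
    using subspace_imp_affine[OF subspace_traceless] affine_translation by blast
  moreover have "aff_dim ?L = 5"
    using subspace_traceless by (simp add: aff_dim_translation_eq aff_dim_subspace dim_traceless)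
  moreover have "?c \<in> ?L"
    using subspace_0[OF subspace_traceless] by (metis add.right_neutral imageI)
  ultimately show "round_sphere 4 (sphere ?c ?r \<inter> ?L)"
    unfolding round_sphere_def using assms
    by (intro exI[of _ ?L] exI[of _ ?c] exI[of _ ?r]) auto
  show "sphere ?c ?r \<inter> ?L \<subseteq> Sym3"
    by (auto simp: traceless_def Sym3_def transpose_def vec_eq_iff mat_def)
  show "veronese a b \<subseteq> sphere ?c ?r \<inter> ?L"
  proof
    fix X assume "X \<in> veronese a b"
    then obtain x where x: "norm x = 1" "X = mat a + b *\<^sub>R outer x x"
      by (auto simp: veronese_def)
    then have xx: "x \<bullet> x = 1"
      by (simp add: norm_eq_1)
    define Z where "Z = outer x x - (1 / 3) *\<^sub>R mat 1"
    have Z: "X - ?c = b *\<^sub>R Z"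
      using x by (simp add: Z_def vec_eq_iff mat_def field_simps)
    have "outer x x \<bullet> mat 1 = 1" "(mat 1 :: real^3^3) \<bullet> mat 1 = 3"
      using xx by (simp_all add: inner_vec_def sum_3 mat_def)
    then have "Z \<bullet> Z = 2 / 3"
      using xx by (simp add: Z_def inner_diff_left inner_diff_right inner_outer inner_commute)
    then have "norm Z = sqrt (2 / 3)"
      by (simp add: norm_eq_sqrt_inner)
    then have "norm (X - ?c) = ?r"
      by (simp add: Z)
    moreover have "Z \<in> traceless"
      using xx by (auto simp: Z_def traceless_def Sym3_def transpose_def trace_def vec_eq_iff
          inner_vec_def sum_3 mat_def)
    then have "b *\<^sub>R Z \<in> traceless"
      using subspace_traceless subspace_scale by blast
    then have "X \<in> ?L"
      using Z by (metis add.commute diff_add_cancel imageI)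
    ultimately show "X \<in> sphere ?c ?r \<inter> ?L"
      by (simp add: dist_norm norm_minus_commute)
  qed
qed

text \<open>Polarisation: \<open>outer (x + y) (x + y) - outer x x - outer y y\<close> is
  \<open>outer x y + outer y x\<close>, and for distinct axes the scalar parts of \<open>Q\<close>
  cancel. So the off-diagonal directions also come from values of \<open>Q\<close> at nonzero
  vectors.\<close>

lemma traceless_expansion:
  fixes Q :: "real ^ 3 \<Rightarrow> real ^ 3 ^ 3"
  defines "Q \<equiv> \<lambda>x. outer x x - mat ((x \<bullet> x) / 3)"
    and "e \<equiv> \<lambda>i. axis i 1"
  assumes "X \<in> traceless"
  shows "X = X $ 1 $ 1 *\<^sub>R Q (e 1) + X $ 2 $ 2 *\<^sub>R Q (e 2) + X $ 3 $ 3 *\<^sub>R Q (e 3)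
    + X $ 1 $ 2 *\<^sub>R (Q (e 1 + e 2) - Q (e 1) - Q (e 2))
    + X $ 1 $ 3 *\<^sub>R (Q (e 1 + e 3) - Q (e 1) - Q (e 3))
    + X $ 2 $ 3 *\<^sub>R (Q (e 2 + e 3) - Q (e 2) - Q (e 3))"
  by (simp add: Q_def e_def traceless_nth[OF assms(3)] vec_eq_iff forall_3 mat_def axis_def
      inner_vec_def sum_3 field_simps)

lemma veronese_not_in_4_plane:
  assumes "b \<noteq> 0" "affine L" "aff_dim L = 4"
  shows "\<not> veronese a b \<subseteq> L"
proof
  assume sub: "veronese a b \<subseteq> L"
  let ?c = "mat (a + b / 3) :: real^3^3"
  have pt: "line_pt a b x \<in> L" if "x \<noteq> 0" for x
    using sub that by (auto simp: veronese_eq_line_pt)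
  \<comment> \<open>The projections onto three orthogonal axes sum to the identity, so averaging
    three orbit points puts the centre of the sphere into \<open>L\<close>; shifted by it,
    \<open>L\<close> becomes a linear subspace.\<close>
  have "(1/3) *\<^sub>R line_pt a b (axis 1 1) + (1/3) *\<^sub>R line_pt a b (axis 2 1) + (1/3) *\<^sub>R line_pt a b (axis 3 1) \<in> L"
    by (intro mem_affine_3 assms pt) auto
  also have "(1/3) *\<^sub>R line_pt a b (axis 1 1) + (1/3) *\<^sub>R line_pt a b (axis 2 1) + (1/3) *\<^sub>R line_pt a b (axis 3 1) = ?c"
    by (simp add: line_pt_def vec_eq_iff forall_3 mat_def axis_def inner_vec_def sum_3 field_simps)
  finally have "?c \<in> L" .
  define V where "V = (\<lambda>X. - ?c + X) ` L"
  have V: "subspace V"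
    unfolding V_def using assms \<open>?c \<in> L\<close> affine_diffs_subspace by blast
  then have "dim V = 4"
    using assms aff_dim_subspace[OF V] aff_dim_translation_eq[of "- ?c" L] by (simp add: V_def)
  define Q where "Q = (\<lambda>x::real^3. outer x x - mat ((x \<bullet> x) / 3))"
  have "Q x \<in> V" if "x \<noteq> 0" for x
  proof -
    have "line_pt a b x - ?c \<in> V"
      unfolding V_def using pt[OF that] by (metis (no_types) add.commute diff_conv_add_uminus imageI)
    moreover have "Q x = ((x \<bullet> x) / b) *\<^sub>R (line_pt a b x - ?c)"
      unfolding line_pt_minus_centre[OF that] Q_def using assms that by simp
    ultimately show ?thesis
      using V subspace_scale by metis
  qed
  moreover have "axis i 1 + axis j 1 \<noteq> (0 :: real^3)" if "i \<noteq> j" for i j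
    using that by (auto simp: vec_eq_iff axis_def intro!: exI[of _ i])
  ultimately have "traceless \<subseteq> V"
  proof (intro subsetI)
    fix X assume Q: "\<And>x. x \<noteq> 0 \<Longrightarrow> Q x \<in> V"
      and e: "\<And>i j. i \<noteq> j \<Longrightarrow> axis i 1 + axis j 1 \<noteq> (0 :: real^3)" and X: "X \<in> traceless"
    show "X \<in> V"
      using traceless_expansion[OF X]
      by (rule ssubst) (intro Q[unfolded Q_def] e subspace_add[OF V] subspace_scale[OF V] subspace_diff[OF V]; simp)
  qed
  then have "dim traceless \<le> dim V"
    by (rule dim_subset)
  with \<open>dim V = 4\<close> show False
    by (simp add: dim_traceless)
qed

section \<open>Circles through a point of the orbit\<close>

text \<open>The circle for \<open>t\<close> consists of the matrices whose line lies in the plane spanned by \<open>e\<close> and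
  \<open>f + t *\<^sub>R g\<close>.\<close>

locale orthonormal_frame =
  fixes a b :: real and e f g :: "real ^ 3"
  assumes b: "b \<noteq> 0"
    and unit: "e \<bullet> e = 1" "f \<bullet> f = 1" "g \<bullet> g = 1"
    and orth: "e \<bullet> f = 0" "e \<bullet> g = 0" "f \<bullet> g = 0"
begin

definition A where "A = mat a + b *\<^sub>R outer e e"
definition h where "h t = f + t *\<^sub>R g"
text \<open>The lines of \<open>e\<close> and \<open>h t\<close> are orthogonal, so \<open>A\<close>
  and \<open>line_pt a b (h t)\<close> are opposite points of the circle: \<open>c t\<close> is
  their midpoint, \<open>u t\<close> the diameter between them and \<open>r\<close> half its length.
  \<open>v t\<close> is the direction orthogonal to \<open>u t\<close> in the plane of the
  circle.\<close>

definition c where "c t = (1 / 2) *\<^sub>R (A + line_pt a b (h t))"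
definition u where "u t = A - line_pt a b (h t)"
definition v where "v t = outer e (h t) + outer (h t) e"
definition r where "r = \<bar>b\<bar> * sqrt 2 / 2"
definition C where "C t = sphere (c t) r \<inter> (+) (c t) ` span {u t, v t}"

lemma orth_h: "e \<bullet> h t = 0" "h t \<bullet> e = 0" and h_sq: "h t \<bullet> h t = 1 + t\<^sup>2" and h_sq_pos: "1 + t\<^sup>2 > 0"
  using unit orth zero_le_power2[of t]
  by (auto simp: h_def inner_add_left inner_add_right inner_commute power2_eq_square
      add_pos_nonneg simp del: zero_le_power2)

lemma h_nonzero: "h t \<noteq> 0"
  using h_sq[of t] h_sq_pos[of t] by auto

lemma line_pt_h: "line_pt a b (h t) = mat a + (b * inverse (1 + t\<^sup>2)) *\<^sub>R outer (h t) (h t)"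
  by (simp add: line_pt_def h_sq divide_inverse)

lemma u_eq: "u t = b *\<^sub>R (outer e e - (1 / (1 + t\<^sup>2)) *\<^sub>R outer (h t) (h t))"
  by (simp add: u_def A_def line_pt_def h_sq algebra_simps)

lemma circle_point:
  "c t + \<alpha> *\<^sub>R u t + \<beta> *\<^sub>R v t = mat a + (b / 2 + \<alpha> * b) *\<^sub>R outer e e
    + ((b / 2 - \<alpha> * b) * inverse (1 + t\<^sup>2)) *\<^sub>R outer (h t) (h t)
    + \<beta> *\<^sub>R (outer e (h t) + outer (h t) e)"
proof -
  \<comment> \<open>Hiding the inverse behind an opaque \<open>k\<close> keeps
    \<open>field_simps\<close> from clearing the denominator.\<close>
  obtain k where k: "k = inverse (1 + t\<^sup>2)"
    by simp
  show ?thesis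
    unfolding c_def u_def v_def A_def line_pt_h k[symmetric]
    by (simp add: vec_eq_iff field_simps)
qed

lemma inner_uv: "u t \<bullet> u t = 2 * b\<^sup>2" "v t \<bullet> v t = 2 * (1 + t\<^sup>2)" "u t \<bullet> v t = 0" "v t \<bullet> u t = 0"
proof -
  have "1 + t * t \<noteq> 0"
    using h_sq_pos[of t] by (simp add: power2_eq_square)
  then show "u t \<bullet> u t = 2 * b\<^sup>2" "v t \<bullet> v t = 2 * (1 + t\<^sup>2)" "u t \<bullet> v t = 0" "v t \<bullet> u t = 0"
    using unit
    by (simp_all add: u_eq v_def inner_add_left inner_add_right inner_diff_left inner_diff_right
        inner_outer orth_h h_sq power2_eq_square) (simp add: field_simps)
qed

lemma norm_u: "norm (u t) = \<bar>b\<bar> * sqrt 2"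
  by (simp add: norm_eq_sqrt_inner inner_uv real_sqrt_mult)

lemma dim_uv: "dim {u t, v t} = 2"
proof -
  have "u t \<bullet> u t \<noteq> 0" "v t \<bullet> v t \<noteq> 0"
    using b h_sq_pos[of t] by (simp_all add: inner_uv)
  then have "u t \<noteq> 0" "v t \<noteq> 0" "u t \<noteq> v t"
    using inner_uv(3)[of t] by auto
  moreover from this have "independent {u t, v t}"
    by (intro pairwise_orthogonal_independent) (auto simp: pairwise_def orthogonal_def inner_uv)
  ultimately show ?thesis
    by (simp add: dim_eq_card_independent)
qed

lemma A_in_C: "A \<in> C t"
proof -
  have "A = c t + (1 / 2) *\<^sub>R u t"
    by (simp add: c_def u_def vec_eq_iff field_simps)
  moreover have "(1 / 2) *\<^sub>R u t \<in> span {u t, v t}"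
    by (intro span_mul span_base) simp
  moreover have "norm ((1 / 2) *\<^sub>R u t) = r"
    by (simp add: norm_u r_def)
  ultimately show ?thesis
    by (auto simp: C_def dist_norm)
qed

lemma line_pt_in_C: "line_pt a b (h t) \<in> C t"
proof -
  have "line_pt a b (h t) = c t + (- 1 / 2) *\<^sub>R u t"
    by (simp add: c_def u_def vec_eq_iff field_simps)
  moreover have "(- 1 / 2) *\<^sub>R u t \<in> span {u t, v t}"
    by (intro span_mul span_base) simp
  moreover have "norm ((- 1 / 2) *\<^sub>R u t) = r"
    by (simp add: norm_u r_def)
  ultimately show ?thesis
    unfolding C_def by (auto simp: dist_norm simp del: scaleR_minus_left)
qed

text \<open>Since \<open>u t\<close> and \<open>v t\<close> are orthogonal, the squared radius
  \<open>b\<^sup>2 / 2\<close> splits into their two contributions.\<close>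

lemma C_expansion:
  assumes "X \<in> C t"
  obtains \<alpha> \<beta> where "X = c t + \<alpha> *\<^sub>R u t + \<beta> *\<^sub>R v t" "2 * b\<^sup>2 * \<alpha>\<^sup>2 + 2 * (1 + t\<^sup>2) * \<beta>\<^sup>2 = b\<^sup>2 / 2"
proof -
  obtain w where w: "w \<in> span {u t, v t}" "X = c t + w" "norm w = r"
    using assms by (auto simp: C_def dist_norm)
  then obtain \<alpha> \<beta> where "w - \<alpha> *\<^sub>R u t = \<beta> *\<^sub>R v t"
    using span_breakdown_eq[of w "u t" "{v t}"] by (auto simp: span_singleton)
  then have w_eq: "w = \<alpha> *\<^sub>R u t + \<beta> *\<^sub>R v t"
    by (simp add: algebra_simps)
  have "w \<bullet> w = b\<^sup>2 / 2"
    unfolding power2_norm_eq_inner[symmetric] w(3) by (simp add: r_def power_mult_distrib power_divide)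
  then have "2 * b\<^sup>2 * \<alpha>\<^sup>2 + 2 * (1 + t\<^sup>2) * \<beta>\<^sup>2 = b\<^sup>2 / 2"
    by (simp add: w_eq inner_add_left inner_add_right inner_uv power2_eq_square algebra_simps)
  with w w_eq that show ?thesis
    by (simp add: add.assoc)
qed

text \<open>Outer products are quadratic, so turning a unit vector by an angle in the plane of
  \<open>e\<close> and \<open>h t\<close> turns its matrix by twice that angle on the circle. The
  point at angle \<theta> therefore comes from the unit vector at angle \<theta>/2 from
  \<open>e\<close>.\<close>

lemma C_subset_veronese: "C t \<subseteq> veronese a b"
proof
  fix X assume "X \<in> C t"
  then obtain \<alpha> \<beta> where X: "X = c t + \<alpha> *\<^sub>R u t + \<beta> *\<^sub>R v t"
    and norm: "2 * b\<^sup>2 * \<alpha>\<^sup>2 + 2 * (1 + t\<^sup>2) * \<beta>\<^sup>2 = b\<^sup>2 / 2"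
    by (rule C_expansion)
  \<comment> \<open>\<open>s\<close> is the length of \<open>h t\<close>, so \<open>e\<close> and
    \<open>h t\<close> divided by \<open>s\<close> are orthonormal.\<close>
  define s where "s = sqrt (1 + t\<^sup>2)"
  have s: "s > 0" "s\<^sup>2 = 1 + t\<^sup>2"
    using h_sq_pos[of t] by (simp_all add: s_def)
  have "(2 * \<alpha>)\<^sup>2 + (2 * \<beta> * s / b)\<^sup>2 = 1"
    using norm b s by (simp add: power_mult_distrib power_divide field_simps)
  then obtain \<theta> where "2 * \<alpha> = cos \<theta>" "2 * \<beta> * s / b = sin \<theta>"
    using sincos_total_2pi by metis
  moreover define p q where "p = cos (\<theta> / 2)" and "q = sin (\<theta> / 2)"
  ultimately have pq: "p\<^sup>2 + q\<^sup>2 = 1" "2 * \<alpha> = p\<^sup>2 - q\<^sup>2" "2 * \<beta> * s / b = 2 * q * p"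
    using cos_double[of "\<theta> / 2"] sin_double[of "\<theta> / 2"] by simp_all
  define x where "x = p *\<^sub>R e + (q / s) *\<^sub>R h t"
  have "x \<bullet> x = 1"
    using pq(1) s(1) unit s(2)[symmetric]
    by (simp add: x_def inner_add_left inner_add_right orth_h h_sq power2_eq_square)
  then have "norm x = 1"
    by (simp add: norm_eq_1)
  moreover have "X = mat a + b *\<^sub>R outer x x"
  proof -
    have \<alpha>: "b * p\<^sup>2 = b / 2 + \<alpha> * b" "b * q\<^sup>2 = b / 2 - \<alpha> * b"
      using pq(1,2) by algebra+
    have \<beta>: "b * p * q / s = \<beta>"
      using pq(3) s b by (simp add: field_simps)
    have "X = mat a + (b / 2 + \<alpha> * b) *\<^sub>R outer e e + ((b / 2 - \<alpha> * b) / s\<^sup>2) *\<^sub>R outer (h t) (h t)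
        + \<beta> *\<^sub>R (outer e (h t) + outer (h t) e)"
      unfolding X circle_point s(2) divide_inverse ..
    also have "\<dots> = mat a + (b * p\<^sup>2) *\<^sub>R outer e e + (b * q\<^sup>2 / s\<^sup>2) *\<^sub>R outer (h t) (h t)
        + (b * p * q / s) *\<^sub>R (outer e (h t) + outer (h t) e)"
      by (simp only: \<alpha> \<beta>)
    also have "\<dots> = mat a + b *\<^sub>R outer x x"
      by (simp add: x_def vec_eq_iff algebra_simps power2_eq_square)
    finally show ?thesis .
  qed
  ultimately show "X \<in> veronese a b"
    unfolding veronese_def by blast
qed

text \<open>All matrices of the circle for \<open>t\<close> map the normal \<open>g - t *\<^sub>R f\<close> of its plane to \<open>a\<close> times itself,
  and among the \<open>line_pt a b (h s)\<close> only that for \<open>s = t\<close> does.\<close>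

lemma inj_C: "inj C"
proof (rule injI)
  fix s t assume "C s = C t"
  then have "line_pt a b (h s) \<in> C t"
    using line_pt_in_C by blast
  then obtain \<alpha> \<beta> where X: "line_pt a b (h s) = c t + \<alpha> *\<^sub>R u t + \<beta> *\<^sub>R v t"
    by (rule C_expansion)
  define n where "n = g - t *\<^sub>R f"
  have n: "e \<bullet> n = 0" "h t \<bullet> n = 0" "h s \<bullet> n = s - t"
    using unit orth inner_commute[of g f]
    by (simp_all add: n_def h_def inner_add_left inner_diff_right)
  have split: "line_pt a b (h s) - mat a = (b / 2 + \<alpha> * b) *\<^sub>R outer e e
      + ((b / 2 - \<alpha> * b) * inverse (1 + t\<^sup>2)) *\<^sub>R outer (h t) (h t)
      + \<beta> *\<^sub>R (outer e (h t) + outer (h t) e)"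
    unfolding X circle_point by simp
  have "(line_pt a b (h s) - mat a) *v n = 0"
    unfolding split
    by (simp add: matrix_vector_mult_add_rdistrib outer_mult_vec n flip: scaleR_matrix_vector_assoc)
  moreover have "(line_pt a b (h s) - mat a) *v n = (b / (1 + s\<^sup>2) * (s - t)) *\<^sub>R h s"
    by (simp add: line_pt_def outer_mult_vec n h_sq flip: scaleR_matrix_vector_assoc)
  ultimately show "s = t"
    using b h_nonzero h_sq_pos[of s] by simp
qed

lemma smooth_circle_family_C: "smooth_circle_family UNIV r C"
  unfolding smooth_circle_family_def
proof (intro conjI exI ballI)
  have h: "Ck_on k UNIV h" for k
    unfolding h_def
    by (intro Ck_on_add Ck_on_const Ck_on_bounded_linear bounded_linear_scaleR_left)
  then have l: "Ck_on k UNIV (\<lambda>t. line_pt a b (h t))" for k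
    by (intro Ck_on_line_pt h_nonzero)
  show "smooth_on UNIV c"
    unfolding c_def using l
    by (intro smooth_on_open Ck_on_bilinear[OF bounded_bilinear_scaleR] Ck_on_add Ck_on_const) auto
  \<comment> \<open>The difference defining \<open>u\<close> is put as a sum with a scalar multiple,
    to fit \<open>Ck_on_add\<close> and \<open>Ck_on_bilinear\<close>.\<close>
  have "Ck_on k UNIV (\<lambda>t. A + (- 1) *\<^sub>R line_pt a b (h t))" for k
    using l by (intro Ck_on_bilinear[OF bounded_bilinear_scaleR] Ck_on_add Ck_on_const) auto
  then show "smooth_on UNIV u"
    unfolding u_def by (intro smooth_on_open) auto
  show "smooth_on UNIV v"
    unfolding v_def using h
    by (intro smooth_on_open Ck_on_bilinear[OF bounded_bilinear_outer] Ck_on_add Ck_on_const) auto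
qed (use inj_C b dim_uv in \<open>auto simp: r_def C_def\<close>)

end

lemma veronese_circles:
  assumes "b \<noteq> 0" "norm e = 1"
  shows "\<exists>I r C. smooth_circle_family I r C \<and> (\<forall>t\<in>I. mat a + b *\<^sub>R outer e e \<in> C t) \<and>
    (\<Union>t\<in>I. C t) \<subseteq> veronese a b"
proof -
  \<comment> \<open>The images of the three axes under a rotation taking the first axis to
    \<open>e\<close> complete \<open>e\<close> to an orthonormal frame.\<close>
  obtain R where R: "rotation_matrix R" "R *v axis (1::3) 1 = e"
    using rotation_matrix_exists_basis[OF _ assms(2), of 1] by auto
  then have "orthogonal_transformation ((*v) R)"
    by (simp add: rotation_matrix_def orthogonal_transformation_matrix)
  then have inner: "(R *v x) \<bullet> (R *v y) = x \<bullet> y" for x y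
    by (simp add: orthogonal_transformation_def)
  interpret orthonormal_frame a b e "R *v axis 2 1" "R *v axis 3 1"
    by unfold_locales (use assms in \<open>simp_all flip: R(2) add: inner inner_axis_axis\<close>)
  show ?thesis
    using smooth_circle_family_C A_in_C C_subset_veronese unfolding A_def by blast
qed

theorem mainTheorem5:
  fixes A :: "real ^ 3 ^ 3"
  assumes "A \<in> Sym3"
    and "\<not> scalar_matrix A"
    and "has_multiple_eigenvalue A"
  shows
    "(algebraic_in_Sym3 (SO3_orbit A) \<and>
      smooth_manifold (top_of_set (SO3_orbit A))
        (submanifold_atlas (SO3_orbit A) :: (real ^ 3 ^ 3, real ^ 2) chart set) \<and>
      (\<exists>S. round_sphere 4 S \<and> S \<subseteq> Sym3 \<and> SO3_orbit A \<subseteq> S) \<and>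
      diffeomorphic (top_of_set (SO3_orbit A))
        (submanifold_atlas (SO3_orbit A) :: (real ^ 3 ^ 3, real ^ 2) chart set)
        RP2_topology RP2_atlas) \<and>
     (\<exists>I r C. smooth_circle_family I r C \<and> (\<forall>t\<in>I. A \<in> C t) \<and>
        (\<Union>t\<in>I. C t) \<subseteq> SO3_orbit A) \<and>
     (\<forall>L. affine L \<and> L \<subseteq> Sym3 \<and> aff_dim L = 4 \<longrightarrow> \<not> SO3_orbit A \<subseteq> L)"
proof -
  obtain a b e where A: "b \<noteq> 0" "norm e = 1" "A = mat a + b *\<^sub>R outer e e"
    using double_eigenvalue_decomposition[OF assms] by blast
  then have orbit: "SO3_orbit A = veronese a b"
    by (simp add: SO3_orbit_rank_one)
  have "diffeomorphic (top_of_set (veronese a b))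
      (submanifold_atlas (veronese a b) :: (real ^ 3 ^ 3, real ^ 2) chart set) RP2_topology RP2_atlas"
    using A(1) by (rule veronese_diffeomorphic_RP2)
  moreover from this have "smooth_manifold (top_of_set (veronese a b))
      (submanifold_atlas (veronese a b) :: (real ^ 3 ^ 3, real ^ 2) chart set)"
    by (simp add: diffeomorphic_def)
  moreover have "algebraic_in_Sym3 (veronese a b)"
    using A(1) by (rule algebraic_veronese)
  moreover have "\<exists>S. round_sphere 4 S \<and> S \<subseteq> Sym3 \<and> veronese a b \<subseteq> S"
    using A(1) by (rule veronese_in_sphere)
  moreover have "\<exists>I r C. smooth_circle_family I r C \<and> (\<forall>t\<in>I. A \<in> C t) \<and> (\<Union>t\<in>I. C t) \<subseteq> veronese a b"
    unfolding A(3) using A(1,2) by (rule veronese_circles)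
  moreover have "\<forall>L. affine L \<and> L \<subseteq> Sym3 \<and> aff_dim L = 4 \<longrightarrow> \<not> veronese a b \<subseteq> L"
    using veronese_not_in_4_plane[OF A(1)] by blast
  ultimately show ?thesis
    unfolding orbit by blast
qed

end
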